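(* Let $\mathcal{A}$ be a unital $C^*$-algebra over $\mathbb{F}$, where $\mathbb{F}=\mathbb{R}$ or $\mathbb{C}$. Let $a\in\mathcal{A}$ and let $\mathcal{B}$ be a subspace of $\mathcal{A}$. If $b_0\in\mathcal{B}$ is a best approximation to $a$ in $\mathcal{B}$, then $$\mathrm{dist}(a,\mathcal{B})^2=\max\{\phi(a^*a)-\phi(b_0^*b_0) : \phi\in\mathcal{S}_{\mathcal{A}} \text{ and } \phi(a^*b)=\phi(b_0^*b)\text{ for all } b\in\mathcal{B}\}$$ (in particular, the maximum is attained).
   Context: $1_{\mathcal{A}}$ denotes the identity of $\mathcal{A}$. "Subspace" means $\mathbb{F}$-linear subspace (not assumed closed). $\mathrm{dist}(a,\mathcal{B})=\inf\{\|a-b\|: b\in\mathcal{B}\}$. An element $b_0\in\mathcal{B}$ is a best approximation to $a$ in $\mathcal{B}$ if $\|a-b_0\|=\mathrm{dist}(a,\mathcal{B})$. $\mathcal{S}_{\mathcal{A}}$ is the set of states on $\mathcal{A}$: for $\mathbb{F}=\mathbb{C}$, a state is a positive linear functional $\phi$ on $\mathcal{A}$ (i.e. mapping positive elements to nonnegative reals) with $\phi(1_{\mathcal{A}})=1$; for $\mathbb{F}=\mathbb{R}$, it is additionally required that $\phi(c^* )=\phi(c)$ for all $c\in\mathcal{A}$. *)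

theory Defs
  imports "HOL-Analysis.Analysis"
begin

text \<open>
  The algebra is a whole type of class \<open>real_normed_algebra_1\<close> and \<open>banach\<close>, so its
  norm is complete and submultiplicative. The class axiom \<open>norm 1 = 1\<close> excludes only the
  zero algebra: in every other unital algebra it follows from the C*-identity.
  The scalar field \<open>'k\<close> acts through \<open>smul\<close>, which extends the real scalar
  multiplication of the class; \<open>conjg\<close> is the conjugation of \<open>'k\<close>.
\<close>

locale unital_cstar_axioms = vector_space smul
  for smul :: "'k::real_normed_field \<Rightarrow> 'a::{real_normed_algebra_1, banach} \<Rightarrow> 'a" +
  fixes conjg :: "'k \<Rightarrow> 'k"
    and star :: "'a \<Rightarrow> 'a"
  assumes scale_of_real: "smul (of_real r) x = r *\<^sub>R x"
    and norm_scale: "norm (smul c x) = norm c * norm x"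
    and scale_mult_left: "smul c x * y = smul c (x * y)"
    and scale_mult_right: "x * smul c y = smul c (x * y)"
    and star_add: "star (x + y) = star x + star y"
    and star_scale: "star (smul c x) = smul (conjg c) (star x)"
    and star_mult: "star (x * y) = star y * star x"
    and star_star: "star (star x) = x"
    and cstar_identity: "norm (star x * x) = (norm x)\<^sup>2"

locale unital_complex_cstar_algebra = unital_cstar_axioms scaleC cnj star
  for scaleC :: "complex \<Rightarrow> 'a::{real_normed_algebra_1, banach} \<Rightarrow> 'a"
    and star :: "'a \<Rightarrow> 'a"

text \<open>
  Over the reals the C*-identity alone is too weak (the complex numbers with trivial involution
  satisfy it); as usual, a real C*-algebra is also required to have \<open>1 + x\<^sup>* x\<close>
  invertible for all \<open>x\<close>. Over the complex numbers this is a theorem.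
\<close>

locale unital_real_cstar_algebra = unital_cstar_axioms scaleR "\<lambda>r::real. r" star
  for star :: "'a::{real_normed_algebra_1, banach} \<Rightarrow> 'a" +
  assumes one_plus_invertible:
    "\<exists>y. y * (1 + star x * x) = 1 \<and> (1 + star x * x) * y = 1"

definition positive_element :: "('a::times \<Rightarrow> 'a) \<Rightarrow> 'a \<Rightarrow> bool" where
  "positive_element star h \<longleftrightarrow> (\<exists>c. h = star c * c)"

definition positive_unital_functionals ::
  "('k::real_normed_field \<Rightarrow> 'a \<Rightarrow> 'a) \<Rightarrow> ('a::real_normed_algebra_1 \<Rightarrow> 'a) \<Rightarrow> ('a \<Rightarrow> 'k) set" where
  "positive_unital_functionals smul star =
     {\<phi>. Vector_Spaces.linear smul (*) \<phi> \<and>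
         (\<forall>h. positive_element star h \<longrightarrow> \<phi> h \<in> \<real>\<^sub>\<ge>\<^sub>0) \<and> \<phi> 1 = 1}"

definition complex_states ::
  "(complex \<Rightarrow> 'a \<Rightarrow> 'a) \<Rightarrow> ('a::real_normed_algebra_1 \<Rightarrow> 'a) \<Rightarrow> ('a \<Rightarrow> complex) set" where
  "complex_states scaleC star = positive_unital_functionals scaleC star"

definition real_states :: "('a::real_normed_algebra_1 \<Rightarrow> 'a) \<Rightarrow> ('a \<Rightarrow> real) set" where
  "real_states star = {\<phi> \<in> positive_unital_functionals scaleR star. \<forall>c. \<phi> (star c) = \<phi> c}"

definition best_approximation :: "'a::real_normed_vector \<Rightarrow> 'a set \<Rightarrow> 'a \<Rightarrow> bool" where
  "best_approximation a B b\<^sub>0 \<longleftrightarrow> b\<^sub>0 \<in> B \<and> norm (a - b\<^sub>0) = infdist a B"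

text \<open>
  Maximum of a set of scalars. For complex scalars this includes the claim that
  all members of the set are real.
\<close>

definition is_maximum :: "real \<Rightarrow> 'k::real_normed_field set \<Rightarrow> bool" where
  "is_maximum m S \<longleftrightarrow> of_real m \<in> S \<and> (\<forall>s\<in>S. \<exists>r\<le>m. s = of_real r)"

end

(*
  Put x = a - b0. A functional in the constraint set annihilates star x * b for b in B, which turns
  phi(star a * a) - phi(star b0 * b0) into phi(star x * x), and this is at most (norm x)^2. For
  attainment, the positivity of all star c * c makes norm (t + star z * z) equal to
  t + (norm z)^2; applied to z = x + e b with e tending to 0, minimality of norm x yields
  t + l (norm x)^2 <= norm (Re (t + l star x * x + star x * b)) for t, l >= 0 and b in B. By the
  Mazur-Orlicz theorem some linear functional lies between the two sides, and it is the required
  state. A complex C*-algebra is a real one by Kaplansky's theorem that 1 + star x * x is invertible,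
  and a real state phi extends to phi(c) - i phi(i c).
*)

theory Submission
  imports Defs
begin

subsection \<open>Invertible elements\<close>


text \<open>The formula for \<open>norm (t + star z * z)\<close> says that the norm of a positive
  element lies in its spectrum. Over the reals there is no resolvent at a complex number to prove
  this with. The product of two conjugate factors, \<open>1 - \<omega> y\<close> and
  \<open>1 - cnj \<omega> y\<close>, has real coefficients and takes its place: for self-adjoint
  \<open>k\<close> it is a completed square, so the invertibility of \<open>1 + k * k\<close>
  controls it. Positivity is expressed by invertibility and norms alone, and square roots come from
  the binomial series, whose commutation property replaces functional calculus.

  One functional has to satisfy several conditions at once: its values at \<open>1\<close> and
  \<open>star x * x\<close>, and its vanishing on all \<open>star x * b\<close>. Extending
  prescribed values would require their consistency on the span of these elements; the Mazur-Orlicz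
  theorem asks only for an inequality on a cone. The real part under the norm makes the functional
  vanish on skew elements, which is the symmetry demanded of a real state.\<close>

definition invertible_element :: "'a::monoid_mult \<Rightarrow> bool" where
  "invertible_element x \<longleftrightarrow> (\<exists>y. y * x = 1 \<and> x * y = 1)"

definition inverse_element :: "'a::monoid_mult \<Rightarrow> 'a" where
  "inverse_element x = (SOME y. y * x = 1 \<and> x * y = 1)"

lemma inverse_element:
  assumes "invertible_element x"
  shows "inverse_element x * x = 1" "x * inverse_element x = 1"
  using assms unfolding invertible_element_def inverse_element_def
  by (metis (mono_tags, lifting) someI_ex)+

lemma invertible_elementI: "y * x = 1 \<Longrightarrow> x * y = 1 \<Longrightarrow> invertible_element x"
  unfolding invertible_element_def by blast

lemma invertible_element_mult:
  assumes "invertible_element x" "invertible_element y"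
  shows "invertible_element (x * y)"
proof -
  obtain u v where "u * x = 1" "x * u = 1" "v * y = 1" "y * v = 1"
    using assms unfolding invertible_element_def by blast
  then show ?thesis
    by (intro invertible_elementI[of "v * u"]) (metis mult.assoc mult_1_left)+
qed

text \<open>Commutation turns the inverse \<open>w\<close> of the product into a left inverse
  \<open>w * y\<close> and a right inverse \<open>y * w\<close> of \<open>x\<close>, and these
  coincide.\<close>

lemma invertible_element_left_factor:
  assumes "invertible_element (x * y)" "x * y = y * x"
  shows "invertible_element x"
proof -
  obtain w where w: "w * (x * y) = 1" "(x * y) * w = 1"
    using assms(1) unfolding invertible_element_def by blast
  have 1: "(w * y) * x = 1"
    using w(1) unfolding assms(2) mult.assoc .
  have 2: "x * (y * w) = 1"
    using w(2) unfolding mult.assoc .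
  have "w * y = (w * y) * (x * (y * w))"
    unfolding 2 by simp
  also have "\<dots> = y * w"
    using 1 by (simp add: mult.assoc[symmetric])
  finally show ?thesis
    using 1 2 by (intro invertible_elementI[of "w * y"]) simp_all
qed

lemma invertible_element_scaleR:
  fixes x :: "'a::real_algebra_1"
  assumes "invertible_element x" "c \<noteq> 0"
  shows "invertible_element (c *\<^sub>R x)"
proof -
  obtain y where "y * x = 1" "x * y = 1"
    using assms(1) unfolding invertible_element_def by blast
  then show ?thesis
    using assms(2) by (intro invertible_elementI[of "(1 / c) *\<^sub>R y"]) simp_all
qed

lemma invertible_element_uminus:
  fixes x :: "'a::real_algebra_1"
  assumes "invertible_element x"
  shows "invertible_element (- x)"
  using invertible_element_scaleR[OF assms, of "-1"] by simp

text \<open>Jacobson's lemma. The inverse \<open>1 + y * w * x\<close> is read off from the formal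
  geometric series of \<open>y * x\<close>, in which that of \<open>x * y\<close> sits between
  \<open>y\<close> and \<open>x\<close>.\<close>

lemma invertible_one_minus_commute:
  fixes x y :: "'a::ring_1"
  assumes "invertible_element (1 - x * y)"
  shows "invertible_element (1 - y * x)"
proof -
  obtain w where w: "w * (1 - x * y) = 1" "(1 - x * y) * w = 1"
    using assms unfolding invertible_element_def by blast
  have a: "w * x * y = w - 1" "x * y * w = w - 1"
    using w by (simp_all add: algebra_simps)
  have "(1 + y * w * x) * (1 - y * x) = 1 - y * x + y * w * x - y * (w * x * y) * x"
    by (simp add: algebra_simps)
  also have "\<dots> = 1"
    unfolding a by (simp add: algebra_simps)
  finally have 1: "(1 + y * w * x) * (1 - y * x) = 1" .
  have "(1 - y * x) * (1 + y * w * x) = 1 - y * x + y * w * x - y * (x * y * w) * x"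
    by (simp add: algebra_simps)
  also have "\<dots> = 1"
    unfolding a by (simp add: algebra_simps)
  finally show ?thesis
    using 1 by (intro invertible_elementI[of "1 + y * w * x"])
qed

lemma invertible_element_Neumann:
  fixes x :: "'a::{real_normed_algebra_1, banach}"
  assumes "norm x < 1"
  shows "invertible_element (1 - x)"
proof -
  have "summable (\<lambda>n. norm x ^ n)"
    using assms by (intro summable_geometric) simp
  then have s: "summable (\<lambda>n. x ^ n)"
    by (rule summable_comparison_test'[where N = 0]) (simp add: norm_power_ineq)
  let ?s = "\<Sum>n. x ^ n"
  have e: "?s = 1 + (\<Sum>n. x ^ Suc n)"
    using suminf_split_head[OF s] by simp
  have "x * ?s = (\<Sum>n. x ^ Suc n)" "?s * x = (\<Sum>n. x ^ Suc n)"
    using suminf_mult[OF s, of x] suminf_mult2[OF s, of x] by (simp_all add: power_commutes)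
  then show ?thesis
    using e by (intro invertible_elementI[of ?s]) (simp_all add: algebra_simps)
qed

lemma invertible_of_real_minus:
  fixes x :: "'a::{real_normed_algebra_1, banach}"
  assumes "norm x < t"
  shows "invertible_element (of_real t - x)"
proof -
  have t: "t > 0"
    using assms norm_ge_zero[of x] by linarith
  then have "norm ((1 / t) *\<^sub>R x) < 1"
    using assms by simp
  from invertible_element_scaleR[OF invertible_element_Neumann[OF this], of t] t
  show ?thesis by (simp add: algebra_simps of_real_def)
qed

lemma inverse_element_diff:
  fixes x y :: "'a::ring_1"
  assumes "invertible_element x" "invertible_element y"
  shows "inverse_element y - inverse_element x = inverse_element y * (x - y) * inverse_element x"
  using inverse_element[OF assms(1)] inverse_element[OF assms(2)]
  by (simp add: algebra_simps)

lemma continuous_on_inverse_element: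
  "continuous_on {x::'a::real_normed_algebra_1. invertible_element x} inverse_element"
  unfolding continuous_on_iff
proof (intro ballI allI impI)
  fix x :: 'a and e :: real
  assume "x \<in> {x. invertible_element x}" and e: "0 < e"
  then have x: "invertible_element x" by simp
  let ?A = "inverse_element x"
  have "?A \<noteq> 0"
    using inverse_element(1)[OF x] by auto
  then have A: "norm ?A > 0" by simp
  \<comment> \<open>The first bound forces \<open>norm ?B \<le> 2 * norm ?A\<close>; with it, the
    second makes the difference of the inverses at most \<open>e / 2\<close>.\<close>
  define d where "d = min (1 / (2 * norm ?A)) (e / (4 * (norm ?A)\<^sup>2))"
  have "d > 0" using A e by (simp add: d_def)
  moreover have "dist (inverse_element y) ?A < e"
    if y: "invertible_element y" and dist: "dist y x < d" for y
  proof -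
    let ?B = "inverse_element y"
    have d1: "norm (x - y) * norm ?A \<le> 1 / 2"
    proof -
      have "norm (x - y) \<le> 1 / (2 * norm ?A)"
        using dist by (simp add: d_def dist_norm norm_minus_commute)
      then show ?thesis using A by (simp add: field_simps)
    qed
    have d2: "norm (x - y) * (norm ?A)\<^sup>2 \<le> e / 4"
    proof -
      have "norm (x - y) \<le> e / (4 * (norm ?A)\<^sup>2)"
        using dist by (simp add: d_def dist_norm norm_minus_commute)
      then show ?thesis using A by (simp add: field_simps)
    qed
    have D: "norm (?B - ?A) \<le> norm ?B * (norm (x - y) * norm ?A)"
      unfolding inverse_element_diff[OF x y] mult.assoc
      by (meson mult_left_mono norm_ge_zero norm_mult_ineq order_trans)
    also have "\<dots> \<le> norm ?B * (1 / 2)"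
      using d1 by (intro mult_left_mono) auto
    finally have "norm ?B \<le> 2 * norm ?A"
      using norm_triangle_ineq2[of ?B ?A] by linarith
    then have "norm ?B * (norm (x - y) * norm ?A) \<le> (2 * norm ?A) * (norm (x - y) * norm ?A)"
      by (intro mult_right_mono) auto
    also have "\<dots> = 2 * (norm (x - y) * (norm ?A)\<^sup>2)"
      by (simp add: power2_eq_square)
    also have "\<dots> < e" using d2 e by linarith
    finally show ?thesis using D by (simp add: dist_norm)
  qed
  ultimately show "\<exists>d>0. \<forall>x'\<in>{x. invertible_element x}. dist x' x < d \<longrightarrow>
      dist (inverse_element x') ?A < e" by blast
qed

subsection \<open>Powers and resolvents\<close>


text \<open>Real part of the geometric sum of an \<open>N\<close>-th root of unity \<open>z\<close>;
  the bounds on \<open>i\<close> ensure \<open>z \<noteq> 1\<close>.\<close>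

lemma sum_cos_roots_of_unity:
  assumes "0 < i" "i < N"
  shows "(\<Sum>j<N. cos (real i * (2 * pi * real j / real N))) = 0"
proof -
  define z where "z = cis (2 * pi * real i / real N)"
  have N: "real N > 0" using assms by simp
  have "z ^ N = cis (2 * pi * of_int (int i))"
    unfolding z_def Complex.DeMoivre using N by (simp add: field_simps)
  then have zN: "z ^ N = 1"
    by (simp only: cis_multiple_2pi Ints_of_int)
  have "z \<noteq> 1"
  proof
    assume "z = 1"
    then have "cos (2 * pi * real i / real N) = 1"
      by (simp add: z_def complex_eq_iff)
    then obtain n :: int where "2 * pi * real i / real N = of_int n * 2 * pi"
      unfolding cos_one_2pi_int by blast
    then have "real i = of_int n * real N"
      using N by (simp add: field_simps)
    then have "int i = n * int N"
      by (metis of_int_eq_iff of_int_mult of_int_of_nat_eq)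
    then have "int N dvd int i" by simp
    then have "N \<le> i" using assms(1) by (simp add: dvd_imp_le)
    then show False using assms(2) by simp
  qed
  then have "(\<Sum>j<N. z ^ j) = 0"
    using zN by (simp add: geometric_sum)
  then have "Re (\<Sum>j<N. z ^ j) = 0" by simp
  moreover have "Re (z ^ j) = cos (real i * (2 * pi * real j / real N))" for j
    by (simp add: z_def Complex.DeMoivre mult_ac)
  ultimately show ?thesis by simp
qed

text \<open>The product of \<open>1 - cis t y\<close> and \<open>1 - cis (- t) y\<close>, multiplied
  out so that only real scalars occur.\<close>

definition resolvent_quadratic :: "real \<Rightarrow> 'a::real_algebra_1 \<Rightarrow> 'a" where
  "resolvent_quadratic t y = 1 - (2 * cos t) *\<^sub>R y + y * y"

text \<open>The mean of the inverses of the two conjugate factors \<open>1 - cis t y\<close> and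
  \<open>1 - cis (- t) y\<close>.\<close>

definition resolvent_real_part :: "real \<Rightarrow> 'a::real_algebra_1 \<Rightarrow> 'a" where
  "resolvent_real_part t y = inverse_element (resolvent_quadratic t y) * (1 - cos t *\<^sub>R y)"

text \<open>The real part of a truncated geometric series telescopes by the recurrence for
  \<open>cos (n t)\<close>. Subtracting in the reals, \<open>real n - 1\<close>, keeps the case
  \<open>n = 0\<close> correct.\<close>

lemma resolvent_quadratic_mult_sum:
  "resolvent_quadratic t y * (\<Sum>i<n. cos (real i * t) *\<^sub>R y ^ i) =
     1 - cos t *\<^sub>R y - cos (real n * t) *\<^sub>R y ^ n + cos ((real n - 1) * t) *\<^sub>R y ^ Suc n"
proof (induction n)
  case 0
  then show ?case by simp
next
  case (Suc n)
  have c: "2 * cos t * cos (real n * t) = cos (real (Suc n) * t) + cos ((real n - 1) * t)"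
    by (simp add: algebra_simps cos_add cos_diff)
  have "resolvent_quadratic t y * (\<Sum>i<Suc n. cos (real i * t) *\<^sub>R y ^ i) =
     1 - cos t *\<^sub>R y - cos (real n * t) *\<^sub>R y ^ n + cos ((real n - 1) * t) *\<^sub>R y ^ Suc n
     + cos (real n * t) *\<^sub>R (resolvent_quadratic t y * y ^ n)"
    using Suc by (simp add: distrib_left)
  also have "resolvent_quadratic t y * y ^ n =
      y ^ n - (2 * cos t) *\<^sub>R y ^ Suc n + y ^ Suc (Suc n)"
    by (simp add: resolvent_quadratic_def algebra_simps)
  also have "cos (real n * t) *\<^sub>R \<dots> = cos (real n * t) *\<^sub>R y ^ n
      - (2 * cos t * cos (real n * t)) *\<^sub>R y ^ Suc n + cos (real n * t) *\<^sub>R y ^ Suc (Suc n)"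
    by (simp add: scaleR_add_right scaleR_diff_right mult_ac)
  finally show ?case
    unfolding c by (simp add: scaleR_add_left)
qed

text \<open>As \<open>N * t\<close> is a multiple of \<open>2 * pi\<close>, the boundary terms of
  the truncated series combine to the factor \<open>1 - y ^ N\<close>.\<close>

lemma resolvent_real_part_mult:
  fixes y :: "'a::real_normed_algebra_1"
  assumes inv: "invertible_element (resolvent_quadratic t y)"
    and t: "t = 2 * pi * real j / real N" and N: "N > 0"
  shows "resolvent_real_part t y * (1 - y ^ N) = (\<Sum>i<N. cos (real i * t) *\<^sub>R y ^ i)"
proof -
  have *: "real N * t = 2 * pi * real j"
    using N t by simp
  have c: "cos (real N * t) = 1" "sin (real N * t) = 0"
    unfolding * using cos_int_2pin[of "int j"] sin_int_2pin[of "int j"] by simp_all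
  then have c': "cos ((real N - 1) * t) = cos t"
    by (simp add: left_diff_distrib cos_diff)
  let ?S = "\<Sum>i<N. cos (real i * t) *\<^sub>R y ^ i"
  have "resolvent_quadratic t y * ?S = (1 - cos t *\<^sub>R y) * (1 - y ^ N)"
    unfolding resolvent_quadratic_mult_sum c c' by (simp add: algebra_simps)
  then have "resolvent_real_part t y * (1 - y ^ N) =
      inverse_element (resolvent_quadratic t y) * (resolvent_quadratic t y * ?S)"
    by (simp add: resolvent_real_part_def mult.assoc)
  then show ?thesis
    by (simp add: mult.assoc[symmetric] inverse_element[OF inv])
qed

text \<open>Partial fractions of the inverse of \<open>1 - y ^ N\<close>: after the sums are
  exchanged, orthogonality of the cosines leaves only the constant term.\<close>

lemma average_resolvent:
  fixes y :: "'a::real_normed_algebra_1"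
  assumes inv: "\<And>t. invertible_element (resolvent_quadratic t y)" and N: "N > 0"
  shows "((1 / real N) *\<^sub>R (\<Sum>j<N. resolvent_real_part (2 * pi * real j / real N) y)) *
           (1 - y ^ N) = 1"
proof -
  define t where "t j = 2 * pi * real j / real N" for j
  have "(\<Sum>j<N. resolvent_real_part (t j) y) * (1 - y ^ N) =
      (\<Sum>j<N. \<Sum>i<N. cos (real i * t j) *\<^sub>R y ^ i)"
    unfolding sum_distrib_right
    by (intro sum.cong refl resolvent_real_part_mult[OF inv]) (auto simp: t_def N)
  also have "\<dots> = (\<Sum>i<N. (\<Sum>j<N. cos (real i * t j)) *\<^sub>R y ^ i)"
    unfolding scaleR_sum_left by (rule sum.swap)
  also have "\<dots> = (\<Sum>i<N. if i = 0 then real N *\<^sub>R 1 else 0)"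
    using sum_cos_roots_of_unity by (intro sum.cong) (auto simp: t_def)
  also have "\<dots> = real N *\<^sub>R 1"
    using N by simp
  finally show ?thesis
    using N by (simp add: t_def)
qed

text \<open>
  Rickart's elementary proof of the spectral radius formula: the averages of the resolvent over
  the \<open>N\<close>-th roots of unity form the inverse of \<open>1 - y ^ N\<close>, and they are equicontinuous
  in the radius. Real scalars force conjugate roots to be paired.
\<close>

lemma power_tendsto_zero_if_resolvents:
  fixes k :: "'a::{real_normed_algebra_1, banach}"
  assumes k: "norm k \<le> 1"
    and inv: "\<And>r t. 0 \<le> r \<Longrightarrow> r \<le> 1 \<Longrightarrow> invertible_element (resolvent_quadratic t (r *\<^sub>R k))"
  shows "(\<lambda>n. k ^ n) \<longlonglongrightarrow> 0"
proof -
  let ?X = "{0..1} \<times> {0..2 * pi} :: (real \<times> real) set"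
  define R where "R = (\<lambda>p. resolvent_real_part (snd p) (fst p *\<^sub>R k))"
  have cont: "continuous_on ?X R"
    unfolding R_def resolvent_real_part_def
  proof (intro continuous_on_mult)
    have "continuous_on ?X (\<lambda>p. resolvent_quadratic (snd p) (fst p *\<^sub>R k))"
      unfolding resolvent_quadratic_def by (intro continuous_intros)
    moreover have "(\<lambda>p. resolvent_quadratic (snd p) (fst p *\<^sub>R k)) ` ?X \<subseteq> {x. invertible_element x}"
      using inv by auto
    ultimately show "continuous_on ?X (\<lambda>p. inverse_element (resolvent_quadratic (snd p) (fst p *\<^sub>R k)))"
      using continuous_on_compose2[OF continuous_on_inverse_element] by blast
  qed (intro continuous_intros)
  have "compact ?X" by (intro compact_Times compact_Icc)
  then have unif: "uniformly_continuous_on ?X R"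
    using cont compact_uniformly_continuous by blast
  show ?thesis
  proof (rule LIMSEQ_I)
    fix e :: real assume e: "0 < e"
    obtain d where d: "d > 0" "\<And>p q. p \<in> ?X \<Longrightarrow> q \<in> ?X \<Longrightarrow> dist q p < d \<Longrightarrow> dist (R q) (R p) < e / 4"
      using unif e unfolding uniformly_continuous_on_def by (metis divide_pos_pos zero_less_numeral)
    \<comment> \<open>A radius below 1, where the powers of \<open>r *\<^sub>R k\<close> tend to 0,
      yet within \<open>d\<close> of 1, so that uniform continuity carries the estimate over to
      radius 1.\<close>
    define r where "r = max (1 / 2) (1 - d / 2)"
    have r: "0 \<le> r" "r < 1" "dist 1 r < d" using d(1) by (auto simp: r_def dist_real_def)
    have "(\<lambda>n. r ^ n) \<longlonglongrightarrow> 0" using r by (intro LIMSEQ_realpow_zero) auto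
    \<comment> \<open>The bound \<open>1 / 2\<close> yields \<open>norm (F r) \<le> 2\<close>, and
      \<open>e / 16\<close> then puts \<open>F r\<close> within \<open>e / 8\<close> of 1. Adding
      \<open>e / 4\<close> for the change of radius and doubling at the end gives
      \<open>3 / 4 * e\<close>.\<close>
    then obtain M where M: "\<And>n. n \<ge> M \<Longrightarrow> norm (r ^ n) < min (1 / 2) (e / 16)"
      using e LIMSEQ_D[of "\<lambda>n. r ^ n" 0 "min (1 / 2) (e / 16)"] by auto
    have "norm (k ^ n) < e" if n: "n \<ge> max M 1" for n
    proof -
      define F where "F s = (1 / real n) *\<^sub>R (\<Sum>j<n. R (s, 2 * pi * real j / real n))" for s
      have n0: "n > 0" using n by simp
      have F: "F s * (1 - (s *\<^sub>R k) ^ n) = 1" if "0 \<le> s" "s \<le> 1" for s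
        using average_resolvent[of "s *\<^sub>R k" n] inv that n0 by (simp add: F_def R_def)
      have "norm (F 1 - F r) \<le> e / 4"
      proof -
        have "norm (\<Sum>j<n. R (1, 2 * pi * real j / real n) - R (r, 2 * pi * real j / real n))
            \<le> (\<Sum>j<n. e / 4)"
        proof (rule sum_norm_le)
          fix j assume "j \<in> {..<n}"
          then have "2 * pi * real j / real n \<in> {0..2 * pi}" by (auto simp: field_simps)
          then have "dist (R (1, 2 * pi * real j / real n)) (R (r, 2 * pi * real j / real n)) < e / 4"
            using r by (intro d(2)) (auto simp: dist_Pair_Pair)
          then show "norm (R (1, 2 * pi * real j / real n) - R (r, 2 * pi * real j / real n)) \<le> e / 4"
            by (simp add: dist_norm)
        qed
        moreover have "F 1 - F r = (1 / real n) *\<^sub>R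
            (\<Sum>j<n. R (1, 2 * pi * real j / real n) - R (r, 2 * pi * real j / real n))"
          by (simp add: F_def scaleR_diff_right sum_subtractf)
        ultimately show ?thesis using n0 by (simp add: field_simps)
      qed
      have kn: "norm (k ^ n) \<le> 1"
        using k by (meson norm_power_ineq order_trans power_le_one norm_ge_zero)
      have rk: "norm ((r *\<^sub>R k) ^ n) \<le> r ^ n"
        using mult_left_mono[OF kn, of "r ^ n"] r(1) by (simp add: scaleR_power)
      then have rk2: "norm ((r *\<^sub>R k) ^ n) \<le> 1 / 2" "norm ((r *\<^sub>R k) ^ n) \<le> e / 16"
        using M[of n] n r(1) by auto
      have Fr: "F r - 1 = F r * (r *\<^sub>R k) ^ n"
        using F[of r] r by (simp add: right_diff_distrib algebra_simps)
      then have "norm (F r - 1) \<le> norm (F r) * norm ((r *\<^sub>R k) ^ n)"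
        by (simp only: norm_mult_ineq)
      moreover have "\<dots> \<le> norm (F r) * (1 / 2)" "\<dots> \<le> norm (F r) * (e / 16)"
        using rk2 by (intro mult_left_mono; simp)+
      moreover have "norm (F r) \<le> norm (F r - 1) + 1"
        using norm_triangle_ineq[of "F r - 1" 1] by simp
      ultimately have "norm (F r) \<le> 2" "norm (F r - 1) \<le> norm (F r) * (e / 16)" by linarith+
      then have "norm (F r - 1) \<le> e / 8"
        using mult_right_mono[of "norm (F r)" 2 "e / 16"] e by linarith
      then have g: "norm (F 1 - 1) \<le> 3 / 8 * e"
        using \<open>norm (F 1 - F r) \<le> e / 4\<close> norm_triangle_ineq[of "F 1 - F r" "F r - 1"] by simp
      \<comment> \<open>Since \<open>F 1\<close> inverts \<open>1 - k ^ n\<close>, closeness of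
        \<open>F 1\<close> to 1 forces \<open>k ^ n\<close> to be small.\<close>
      have "k ^ n = (F 1 - 1) - (F 1 - 1) * k ^ n"
        using F[of 1] by (simp add: algebra_simps)
      then have "norm (k ^ n) \<le> norm (F 1 - 1) + norm ((F 1 - 1) * k ^ n)"
        by (metis norm_triangle_ineq4)
      also have "\<dots> \<le> norm (F 1 - 1) + norm (F 1 - 1) * norm (k ^ n)"
        by (simp add: norm_mult_ineq)
      also have "\<dots> \<le> norm (F 1 - 1) + norm (F 1 - 1)"
        using mult_left_mono[OF kn, of "norm (F 1 - 1)"] by simp
      also have "\<dots> < e" using g e by linarith
      finally show ?thesis .
    qed
    then show "\<exists>n0. \<forall>n\<ge>n0. norm (k ^ n - 0) < e"
      by (intro exI[of _ "max M 1"]) simp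
  qed
qed

subsection \<open>Square roots\<close>


text \<open>Coefficients of the binomial series of the square root of \<open>1 - x\<close>.\<close>

definition sqrt_coeff :: "nat \<Rightarrow> real" where
  "sqrt_coeff n = (- 1) ^ n * ((1 / 2) gchoose n)"

text \<open>Partial sums are the coefficients after division by \<open>1 - x\<close>, hence those of
  the power series with exponent \<open>- 1 / 2\<close>.\<close>

lemma sum_sqrt_coeff: "(\<Sum>i\<le>n. sqrt_coeff i) = (- 1) ^ n * ((- 1 / 2) gchoose n)"
  using gbinomial_sum_lower_neg[of "1 / 2 :: real" n] by (simp add: sqrt_coeff_def mult.commute)

lemma sum_sqrt_coeff_nonneg: "(\<Sum>i\<le>n. sqrt_coeff i) \<ge> 0"
proof -
  have "(- 1) ^ n * ((- 1 / 2) gchoose n) = (pochhammer (1 / 2) n :: real) / fact n"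
    by (simp add: gbinomial_pochhammer)
  then show ?thesis
    by (simp add: sum_sqrt_coeff pochhammer_nonneg)
qed

lemma sqrt_coeff_Suc_nonpos: "sqrt_coeff (Suc n) \<le> 0"
proof -
  have "sqrt_coeff (Suc n) = pochhammer (- (1 / 2)) (Suc n) / fact (Suc n)"
    by (simp add: sqrt_coeff_def gbinomial_pochhammer)
  also have "pochhammer (- (1 / 2) :: real) (Suc n) = - (1 / 2) * pochhammer (1 / 2) n"
    by (simp add: pochhammer_rec)
  finally show ?thesis
    by (simp add: pochhammer_nonneg divide_nonpos_pos)
qed

lemma sqrt_coeff_0: "sqrt_coeff 0 = 1"
  by (simp add: sqrt_coeff_def)

text \<open>Past the leading 1 no coefficient is positive, so this sum is 1 minus a nonnegative
  partial sum. It secures absolute convergence on the closed unit ball.\<close>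

lemma sum_abs_sqrt_coeff_Suc_le: "(\<Sum>i<n. \<bar>sqrt_coeff (Suc i)\<bar>) \<le> 1"
proof -
  have "(\<Sum>i<n. \<bar>sqrt_coeff (Suc i)\<bar>) = - (\<Sum>i<n. sqrt_coeff (Suc i))"
    using sqrt_coeff_Suc_nonpos by (simp add: sum_negf abs_of_nonpos)
  also have "\<dots> = 1 - (\<Sum>i\<le>n. sqrt_coeff i)"
    using sum.lessThan_Suc_shift[of sqrt_coeff n] by (simp add: sqrt_coeff_0 lessThan_Suc_atMost)
  finally show ?thesis using sum_sqrt_coeff_nonneg[of n] by simp
qed

lemma summable_abs_sqrt_coeff_Suc: "summable (\<lambda>n. \<bar>sqrt_coeff (Suc n)\<bar>)"
  by (rule bounded_imp_summable[where B = 1])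
    (auto simp only: lessThan_Suc_atMost[symmetric] abs_idempotent abs_ge_zero sum_abs_sqrt_coeff_Suc_le)

lemma suminf_abs_sqrt_coeff_Suc_le: "(\<Sum>n. \<bar>sqrt_coeff (Suc n)\<bar>) \<le> 1"
  using sum_abs_sqrt_coeff_Suc_le by (intro suminf_le_const[OF summable_abs_sqrt_coeff_Suc]) simp

text \<open>Vandermonde's identity with \<open>1 / 2 + 1 / 2 = 1\<close>: the square of the series
  is \<open>1 - x\<close>.\<close>

lemma sum_sqrt_coeff_convolution:
  "(\<Sum>i\<le>n. sqrt_coeff i * sqrt_coeff (n - i)) = (if n = 0 then 1 else if n = 1 then - 1 else 0)"
proof -
  have "(\<Sum>i\<le>n. sqrt_coeff i * sqrt_coeff (n - i)) =
      (\<Sum>i\<le>n. (- 1) ^ n * (((1 / 2) gchoose i) * ((1 / 2) gchoose (n - i))))"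
  proof (rule sum.cong)
    fix i assume "i \<in> {..n}"
    then have "(- 1 :: real) ^ i * (- 1) ^ (n - i) = (- 1) ^ n"
      by (simp add: power_add[symmetric])
    then show "sqrt_coeff i * sqrt_coeff (n - i) =
        (- 1) ^ n * (((1 / 2) gchoose i) * ((1 / 2) gchoose (n - i)))"
      by (simp add: sqrt_coeff_def)
  qed simp
  also have "\<dots> = (- 1) ^ n * ((1 / 2 + 1 / 2 :: real) gchoose n)"
    by (simp only: gbinomial_Vandermonde[symmetric] sum_distrib_left atLeast0AtMost)
  also have "(1 / 2 + 1 / 2 :: real) gchoose n = of_nat (1 choose n)"
    by (simp add: binomial_gbinomial)
  also have "(- 1) ^ n * \<dots> = (if n = 0 then 1 else if n = 1 then - 1 else 0)"
    by (cases n) (auto simp: binomial_eq_0)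
  finally show ?thesis .
qed

definition sqrt_one_minus :: "'a::{real_normed_algebra_1, banach} \<Rightarrow> 'a" where
  "sqrt_one_minus x = (\<Sum>n. sqrt_coeff n *\<^sub>R x ^ n)"

context
  fixes x :: "'a::{real_normed_algebra_1, banach}"
  assumes x: "norm x \<le> 1"
begin

lemma norm_sqrt_term_le: "norm (sqrt_coeff n *\<^sub>R x ^ n) \<le> \<bar>sqrt_coeff n\<bar>"
proof -
  have "norm (x ^ n) \<le> 1"
    using x by (meson norm_power_ineq order_trans power_le_one norm_ge_zero)
  then show ?thesis
    using mult_left_mono[of _ 1 "\<bar>sqrt_coeff n\<bar>"] by simp
qed

lemma summable_norm_sqrt_series: "summable (\<lambda>n. norm (sqrt_coeff n *\<^sub>R x ^ n))"
proof (rule summable_comparison_test'[where N = 0])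
  show "summable (\<lambda>n. \<bar>sqrt_coeff n\<bar>)"
    using summable_abs_sqrt_coeff_Suc summable_Suc_iff[of "\<lambda>n. \<bar>sqrt_coeff n\<bar>"] by simp
qed (use norm_sqrt_term_le in simp)

lemma sums_sqrt_one_minus: "(\<lambda>n. sqrt_coeff n *\<^sub>R x ^ n) sums sqrt_one_minus x"
  unfolding sqrt_one_minus_def
  by (rule summable_sums[OF summable_norm_cancel[OF summable_norm_sqrt_series]])

lemma sqrt_one_minus_square: "sqrt_one_minus x * sqrt_one_minus x = 1 - x"
proof -
  have "(\<lambda>n. \<Sum>i\<le>n. (sqrt_coeff i *\<^sub>R x ^ i) * (sqrt_coeff (n - i) *\<^sub>R x ^ (n - i)))
      sums (sqrt_one_minus x * sqrt_one_minus x)"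
    unfolding sqrt_one_minus_def
    by (rule Cauchy_product_sums[OF summable_norm_sqrt_series summable_norm_sqrt_series])
  moreover have "(\<Sum>i\<le>n. (sqrt_coeff i *\<^sub>R x ^ i) * (sqrt_coeff (n - i) *\<^sub>R x ^ (n - i))) =
      (if n = 0 then 1 else if n = 1 then - 1 else 0) *\<^sub>R x ^ n" for n
  proof -
    have "(\<Sum>i\<le>n. (sqrt_coeff i *\<^sub>R x ^ i) * (sqrt_coeff (n - i) *\<^sub>R x ^ (n - i))) =
        (\<Sum>i\<le>n. sqrt_coeff i * sqrt_coeff (n - i)) *\<^sub>R x ^ n"
      unfolding scaleR_sum_left by (intro sum.cong) (auto simp: power_add[symmetric] mult.commute)
    then show ?thesis by (simp only: sum_sqrt_coeff_convolution)
  qed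
  moreover have "(\<lambda>n. (if n = 0 then 1 else if n = 1 then - 1 else 0) *\<^sub>R x ^ n) sums
      (\<Sum>n\<in>{0, 1}. (if n = 0 then 1 else if n = 1 then - 1 else 0) *\<^sub>R x ^ n)"
    by (rule sums_finite) auto
  ultimately show ?thesis
    by (simp add: sums_iff)
qed

text \<open>This bound is the norm criterion by which the square root will be recognised as
  positive.\<close>

lemma norm_one_minus_sqrt_one_minus_le: "norm (1 - sqrt_one_minus x) \<le> 1"
proof -
  have s: "summable (\<lambda>n. norm (sqrt_coeff (Suc n) *\<^sub>R x ^ Suc n))"
    using summable_norm_sqrt_series by (subst summable_Suc_iff)
  have "sqrt_one_minus x = 1 + (\<Sum>n. sqrt_coeff (Suc n) *\<^sub>R x ^ Suc n)"
    unfolding sqrt_one_minus_def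
    by (subst suminf_split_head[OF summable_norm_cancel[OF summable_norm_sqrt_series]])
      (simp add: sqrt_coeff_0)
  then have "norm (1 - sqrt_one_minus x) = norm (\<Sum>n. sqrt_coeff (Suc n) *\<^sub>R x ^ Suc n)"
    by simp
  also have "\<dots> \<le> (\<Sum>n. norm (sqrt_coeff (Suc n) *\<^sub>R x ^ Suc n))"
    by (rule summable_norm[OF s])
  also have "\<dots> \<le> (\<Sum>n. \<bar>sqrt_coeff (Suc n)\<bar>)"
    by (intro suminf_le s summable_abs_sqrt_coeff_Suc norm_sqrt_term_le)
  also have "\<dots> \<le> 1"
    by (rule suminf_abs_sqrt_coeff_Suc_le)
  finally show ?thesis .
qed

lemma sqrt_one_minus_commute:
  assumes "z * x = x * z"
  shows "z * sqrt_one_minus x = sqrt_one_minus x * z"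
proof -
  have "z * x ^ n = x ^ n * z" for n
    using power_commuting_commutes[of x z n] assms by simp
  then have "(\<lambda>n. z * (sqrt_coeff n *\<^sub>R x ^ n)) = (\<lambda>n. (sqrt_coeff n *\<^sub>R x ^ n) * z)"
    by simp
  with sums_mult[OF sums_sqrt_one_minus, of z] sums_mult2[OF sums_sqrt_one_minus, of z]
  show ?thesis by (metis sums_unique2)
qed

end

subsection \<open>Sublinear functionals\<close>


definition sublinear :: "('a::real_vector \<Rightarrow> real) \<Rightarrow> bool" where
  "sublinear p \<longleftrightarrow> (\<forall>x y. p (x + y) \<le> p x + p y) \<and> (\<forall>c x. 0 \<le> c \<longrightarrow> p (c *\<^sub>R x) = c * p x)"

lemma sublinearD:
  assumes "sublinear p"
  shows "p (x + y) \<le> p x + p y" "0 \<le> c \<Longrightarrow> p (c *\<^sub>R x) = c * p x" "p 0 = 0" "- p (- x) \<le> p x"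
proof -
  show *: "p (x + y) \<le> p x + p y" "0 \<le> c \<Longrightarrow> p (c *\<^sub>R x) = c * p x" for x y c
    using assms unfolding sublinear_def by auto
  show 0: "p 0 = 0"
    using *(2)[of 0 0] by simp
  show "- p (- x) \<le> p x"
    using *(1)[of x "- x"] 0 by simp
qed

lemma cInf_subadditive:
  fixes A B C :: "real set"
  assumes "A \<noteq> {}" "B \<noteq> {}" "bdd_below C" and le: "\<And>a b. a \<in> A \<Longrightarrow> b \<in> B \<Longrightarrow> \<exists>c\<in>C. c \<le> a + b"
  shows "Inf C \<le> Inf A + Inf B"
proof -
  have "Inf C - b \<le> Inf A" if b: "b \<in> B" for b
  proof (rule cInf_greatest[OF assms(1)])
    fix a assume "a \<in> A"
    then obtain c where c: "c \<in> C" "c \<le> a + b" using le b by blast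
    then show "Inf C - b \<le> a" using cInf_lower[OF c(1) assms(3)] by linarith
  qed
  then have "Inf C - Inf A \<le> b" if "b \<in> B" for b
    using that by (simp add: algebra_simps)
  then have "Inf C - Inf A \<le> Inf B"
    by (intro cInf_greatest[OF assms(2)])
  then show ?thesis by simp
qed

text \<open>The new functional is the infimum of \<open>q (x + g k) - m k\<close> over
  \<open>k \<in> K\<close>. It builds the lower bounds \<open>m k\<close> into an upper bound, so
  that any linear functional below it respects both; \<open>le_q\<close> keeps the infimum
  finite.\<close>

lemma sublinear_refine:
  fixes q :: "'a::real_vector \<Rightarrow> real" and K :: "'b::real_vector set"
  assumes q: "sublinear q" and g: "linear g" and m: "linear m"
    and K0: "0 \<in> K" and Kadd: "\<And>k l. k \<in> K \<Longrightarrow> l \<in> K \<Longrightarrow> k + l \<in> K"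
    and Kscale: "\<And>c k. 0 < c \<Longrightarrow> k \<in> K \<Longrightarrow> c *\<^sub>R k \<in> K"
    and le_q: "\<And>k. k \<in> K \<Longrightarrow> m k \<le> q (g k)"
  obtains q' where "sublinear q'" "\<And>x k. k \<in> K \<Longrightarrow> q' x \<le> q (x + g k) - m k"
proof -
  define S where "S x = (\<lambda>k. q (x + g k) - m k) ` K" for x
  have bdd: "bdd_below (S x)" for x
  proof (rule bdd_belowI)
    fix s assume "s \<in> S x"
    then obtain k where k: "k \<in> K" "s = q (x + g k) - m k" by (auto simp: S_def)
    have "m k \<le> q ((x + g k) + - x)"
      using le_q[OF k(1)] by simp
    also have "\<dots> \<le> q (x + g k) + q (- x)" by (rule sublinearD(1)[OF q])
    finally show "- q (- x) \<le> s" using k by simp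
  qed
  have ne: "S x \<noteq> {}" for x using K0 by (auto simp: S_def)
  have S: "q (x + g k) - m k \<in> S x" if "k \<in> K" for x k
    using that by (auto simp: S_def)
  have sub: "Inf (S (u + v)) \<le> Inf (S u) + Inf (S v)" for u v
  proof (rule cInf_subadditive[OF ne ne bdd])
    fix a b assume "a \<in> S u" "b \<in> S v"
    then obtain k l where kl: "k \<in> K" "l \<in> K" "a = q (u + g k) - m k" "b = q (v + g l) - m l"
      by (auto simp: S_def)
    have "q ((u + v) + g (k + l)) \<le> q (u + g k) + q (v + g l)"
      using sublinearD(1)[OF q, of "u + g k" "v + g l"] by (simp add: linear_add[OF g] algebra_simps)
    then have "q ((u + v) + g (k + l)) - m (k + l) \<le> a + b"
      using kl by (simp add: linear_add[OF m])
    then show "\<exists>c\<in>S (u + v). c \<le> a + b"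
      using S[OF Kadd[OF kl(1,2)], of "u + v"] by blast
  qed
  have pos: "Inf (S (c *\<^sub>R x)) = c * Inf (S x)" if "0 < c" for c x
  proof -
    have half: "c * Inf (S x) \<le> Inf (S (c *\<^sub>R x))" if c: "0 < c" for c x
    proof (rule cInf_greatest[OF ne])
      fix s assume "s \<in> S (c *\<^sub>R x)"
      then obtain k where k: "k \<in> K" "s = q (c *\<^sub>R x + g k) - m k" by (auto simp: S_def)
      define l where "l = (1 / c) *\<^sub>R k"
      have l: "l \<in> K" "k = c *\<^sub>R l" using k(1) c by (auto simp: l_def Kscale)
      have "s = c * (q (x + g l) - m l)"
        using sublinearD(2)[OF q, of c "x + g l"] c
        by (simp add: k(2) l(2) linear_scale[OF g] linear_scale[OF m] scaleR_add_right right_diff_distrib)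
      moreover have "Inf (S x) \<le> q (x + g l) - m l"
        by (intro cInf_lower[OF S bdd] l)
      ultimately show "c * Inf (S x) \<le> s" using c by simp
    qed
    \<comment> \<open>The reverse inequality is the same one for the scalar \<open>1 / c\<close> at
      the point \<open>c *\<^sub>R x\<close>.\<close>
    have "(1 / c) * Inf (S (c *\<^sub>R x)) \<le> Inf (S x)"
      using half[of "1 / c" "c *\<^sub>R x"] that by simp
    then show ?thesis using half[OF that, of x] that by (simp add: field_simps)
  qed
  have "sublinear (\<lambda>x. Inf (S x))"
    unfolding sublinear_def
  proof (intro conjI allI impI sub)
    fix c :: real and x assume "0 \<le> c"
    \<comment> \<open>The member given by \<open>k = 0\<close> bounds the infimum by 0 from above;
      subadditivity at 0 bounds it from below.\<close>
    moreover have "Inf (S 0) = 0"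
      using cInf_lower[OF S[OF K0, of 0] bdd] sublinearD(3)[OF q] sub[of 0 0]
      by (simp add: linear_0[OF g] linear_0[OF m])
    ultimately show "Inf (S (c *\<^sub>R x)) = c * Inf (S x)"
      using pos by (cases "c = 0") auto
  qed
  moreover have "Inf (S x) \<le> q (x + g k) - m k" if "k \<in> K" for x k
    by (intro cInf_lower[OF S bdd] that)
  ultimately show ?thesis using that by blast
qed

text \<open>Hahn-Banach by Zorn's lemma on sublinear functionals: a minimal one below
  \<open>p\<close> is already linear.\<close>

theorem sublinear_dominates_linear:
  assumes p: "sublinear p"
  obtains f where "linear f" "\<And>x. f x \<le> p x"
proof -
  define A where "A = {q. sublinear q \<and> (\<forall>x. q x \<le> p x)}"
  \<comment> \<open>The order is reversed, so that maximal elements are minimal functionals.\<close>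
  define P where "P = (\<lambda>q q'::'a \<Rightarrow> real. \<forall>x. q' x \<le> q x)"
  have "\<exists>m\<in>A. \<forall>a\<in>A. P m a \<longrightarrow> a = m"
  proof (rule predicate_Zorn)
    show "partial_order_on A (relation_of P A)"
      by (intro partial_order_on_relation_ofI) (auto simp: P_def fun_eq_iff intro: order_trans antisym)
  next
    fix C assume C: "C \<in> Chains (relation_of P A)"
    then have CA: "C \<subseteq> A" unfolding Chains_def relation_of_def by auto
    have tot: "P q q' \<or> P q' q" if "q \<in> C" "q' \<in> C" for q q'
      using C that unfolding Chains_def relation_of_def by blast
    show "\<exists>u\<in>A. \<forall>a\<in>C. P a u"
    proof (cases "C = {}")
      case True
      then show ?thesis using p by (auto simp: A_def)
    next
      case False
      define S where "S x = (\<lambda>q. q x) ` C" for x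
      have ne: "S x \<noteq> {}" for x using False by (auto simp: S_def)
      have bdd: "bdd_below (S x)" for x
      proof (rule bdd_belowI)
        fix s assume "s \<in> S x"
        then obtain q where q: "q \<in> A" "s = q x" using CA by (auto simp: S_def)
        then show "- p (- x) \<le> s"
          using sublinearD(4)[of q x] unfolding A_def by (metis mem_Collect_eq neg_le_iff_le order_trans)
      qed
      have le: "Inf (S x) \<le> q x" if "q \<in> C" for q x
        using that by (intro cInf_lower bdd) (auto simp: S_def)
      have "sublinear (\<lambda>x. Inf (S x))"
        unfolding sublinear_def
      proof (intro conjI allI impI)
        fix u v
        show "Inf (S (u + v)) \<le> Inf (S u) + Inf (S v)"
        proof (rule cInf_subadditive[OF ne ne bdd])
          fix a b assume "a \<in> S u" "b \<in> S v"
          then obtain q q' where q: "q \<in> C" "q' \<in> C" "a = q u" "b = q' v" by (auto simp: S_def)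
          then obtain r where r: "r \<in> C" "r u \<le> a" "r v \<le> b"
            using tot[of q q'] unfolding P_def by blast
          then have "r (u + v) \<le> a + b"
            using CA sublinearD(1)[of r u v] by (fastforce simp: A_def)
          then show "\<exists>c\<in>S (u + v). c \<le> a + b" using r by (auto simp: S_def)
        qed
      next
        fix c :: real and x assume c: "0 \<le> c"
        have "S (c *\<^sub>R x) = (\<lambda>s. c * s) ` S x"
          using CA sublinearD(2) c by (force simp: S_def A_def image_image intro: image_cong)
        moreover have "continuous (at_right (Inf (S x))) (\<lambda>s. c * s)"
          by (intro continuous_intros)
        ultimately show "Inf (S (c *\<^sub>R x)) = c * Inf (S x)"
          using continuous_at_Inf_mono[of "\<lambda>s. c * s" "S x"] c ne bdd
          by (simp add: mono_def mult_left_mono)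
      qed
      moreover have "Inf (S x) \<le> p x" for x
        using le False CA by (force simp: A_def intro: order_trans)
      ultimately show ?thesis
        using le by (intro bexI[of _ "\<lambda>x. Inf (S x)"]) (auto simp: A_def P_def)
    qed
  qed
  then obtain f where f: "sublinear f" "\<And>x. f x \<le> p x"
    and min: "\<And>q. sublinear q \<Longrightarrow> (\<And>x. q x \<le> p x) \<Longrightarrow> (\<And>x. q x \<le> f x) \<Longrightarrow> q = f"
    unfolding A_def P_def by blast
  have odd: "f (- y) = - f y" for y
  proof -
    \<comment> \<open>Refining \<open>f\<close> along the ray of \<open>y\<close> gives nothing
      smaller, by minimality; but the refinement at \<open>- y\<close> with \<open>t = 1\<close> is
      at most \<open>- f y\<close>.\<close>
    obtain q where q: "sublinear q"
      and le: "\<And>x t. t \<in> {0..} \<Longrightarrow> q x \<le> f (x + t *\<^sub>R y) - t * f y"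
    proof (rule sublinear_refine[OF f(1), of "\<lambda>t. t *\<^sub>R y" "\<lambda>t. t * f y" "{0::real..}"])
      show "linear (\<lambda>t. t *\<^sub>R y)" "linear (\<lambda>t. t * f y)"
        by (auto intro!: linearI simp: algebra_simps)
      show "t * f y \<le> f (t *\<^sub>R y)" if "t \<in> {0..}" for t
        using sublinearD(2)[OF f(1)] that by simp
    qed auto
    have q': "q x \<le> f x" for x using le[of 0 x] by simp
    then have "q = f" using f(2) order_trans q by (intro min) blast+
    moreover have "q (- y) \<le> - f y"
      using le[of 1 "- y"] sublinearD(3)[OF f(1)] by simp
    ultimately show ?thesis using sublinearD(4)[OF f(1), of y] by simp
  qed
  have "linear f"
  proof (rule linearI)
    fix x y
    have "f (- x + - y) \<le> f (- x) + f (- y)" by (rule sublinearD(1)[OF f(1)])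
    then show "f (x + y) = f x + f y"
      using odd[of "x + y"] odd[of x] odd[of y] sublinearD(1)[OF f(1), of x y] by simp
  next
    fix c x
    show "f (c *\<^sub>R x) = c *\<^sub>R f x"
    proof (cases "0 \<le> c")
      case True
      then show ?thesis using sublinearD(2)[OF f(1)] by simp
    next
      case False
      then show ?thesis using sublinearD(2)[OF f(1), of "- c" x] odd[of "c *\<^sub>R x"] by simp
    qed
  qed
  then show ?thesis using f(2) that by blast
qed

text \<open>For \<open>f\<close> below the refined functional, \<open>k = 0\<close> gives
  \<open>f \<le> q\<close>, and evaluation at \<open>- g k\<close> gives
  \<open>m k \<le> f (g k)\<close>.\<close>

corollary Mazur_Orlicz:
  fixes q :: "'a::real_vector \<Rightarrow> real" and K :: "'b::real_vector set"
  assumes q: "sublinear q" and g: "linear g" and m: "linear m"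
    and "0 \<in> K" "\<And>k l. k \<in> K \<Longrightarrow> l \<in> K \<Longrightarrow> k + l \<in> K"
    and "\<And>c k. 0 < c \<Longrightarrow> k \<in> K \<Longrightarrow> c *\<^sub>R k \<in> K"
    and "\<And>k. k \<in> K \<Longrightarrow> m k \<le> q (g k)"
  obtains f where "linear f" "\<And>x. f x \<le> q x" "\<And>k. k \<in> K \<Longrightarrow> m k \<le> f (g k)"
proof -
  obtain q' where q': "sublinear q'" "\<And>x k. k \<in> K \<Longrightarrow> q' x \<le> q (x + g k) - m k"
    using sublinear_refine[OF assms] by blast
  obtain f where f: "linear f" "\<And>x. f x \<le> q' x"
    using sublinear_dominates_linear[OF q'(1)] by blast
  have "f x \<le> q x" for x
    using f(2)[of x] q'(2)[OF \<open>0 \<in> K\<close>, of x] by (simp add: linear_0[OF g] linear_0[OF m])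
  moreover have "m k \<le> f (g k)" if "k \<in> K" for k
    using f(2)[of "- g k"] q'(2)[OF that, of "- g k"] sublinearD(3)[OF q]
    by (simp add: linear_neg[OF f(1)])
  ultimately show ?thesis using f(1) that by blast
qed

subsection \<open>Positivity in hermitian algebras\<close>


text \<open>A complex algebra enters at this level and then earns the invertibility assumptions of
  \<open>hermitian_cstar\<close> and \<open>unital_real_cstar_algebra\<close> in turn.\<close>

locale involutive_cstar = unital_cstar_axioms "scaleR" "\<lambda>r::real. r" star
  for star :: "'a::{real_normed_algebra_1, banach} \<Rightarrow> 'a"
begin

lemma star_scaleR: "star (r *\<^sub>R x) = r *\<^sub>R star x"
  by (rule star_scale)

lemma linear_star: "linear star"
  by (rule linearI) (simp_all add: star_add star_scaleR)

lemmas star_simps = star_add star_scaleR star_mult star_star linear_0[OF linear_star]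
  linear_neg[OF linear_star] linear_diff[OF linear_star]

lemma star_one: "star 1 = 1"
  using star_mult[of "star 1" 1] by (simp add: star_star)

lemma star_of_real: "star (of_real r) = of_real r"
  by (simp add: of_real_def star_scaleR star_one)

lemma norm_star: "norm (star x) = norm x"
proof -
  have *: "norm x \<le> norm (star x)" for x
  proof (cases "x = 0")
    case False
    have "norm x * norm x \<le> norm (star x) * norm x"
      using norm_mult_ineq[of "star x" x] by (simp add: cstar_identity power2_eq_square)
    then show ?thesis using False by simp
  qed simp
  show ?thesis using *[of x] *[of "star x"] by (simp add: star_star)
qed

lemma bounded_linear_star: "bounded_linear star"
  by (intro bounded_linear_intro[where K = 1]) (simp_all add: star_add star_scaleR norm_star)

lemma star_mult_self_eq_0: "star x * x = 0 \<Longrightarrow> x = 0"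
  using cstar_identity[of x] by simp

lemma selfadjoint_square_norm: "star k = k \<Longrightarrow> norm (k * k) = (norm k)\<^sup>2"
  using cstar_identity[of k] by simp

lemma star_power: "star (x ^ n) = star x ^ n"
  by (induction n) (simp_all add: star_one star_mult power_commutes)

lemma selfadjoint_norm_power: "star k = k \<Longrightarrow> norm (k ^ (2 ^ n)) = norm k ^ (2 ^ n)"
proof (induction n)
  case (Suc n)
  have "k ^ (2 ^ Suc n) = k ^ (2 ^ n) * k ^ (2 ^ n)"
    by (simp add: power_add[symmetric] mult_2)
  then show ?case
    using Suc selfadjoint_square_norm[of "k ^ (2 ^ n)"]
    by (simp add: star_power power_mult[symmetric] mult.commute)
qed simp

lemma star_sqrt_one_minus:
  assumes "norm x \<le> 1" "star x = x"
  shows "star (sqrt_one_minus x) = sqrt_one_minus x"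
proof -
  have "(\<lambda>n. star (sqrt_coeff n *\<^sub>R x ^ n)) sums star (sqrt_one_minus x)"
    by (rule bounded_linear.sums[OF bounded_linear_star sums_sqrt_one_minus[OF assms(1)]])
  then show ?thesis
    using sums_sqrt_one_minus[OF assms(1)] assms(2)
    by (simp add: star_scaleR star_power sums_iff)
qed

text \<open>Only the absence of negative real numbers from the spectrum is demanded, so that no
  complex scalars have to be adjoined.\<close>

definition pos :: "'a \<Rightarrow> bool" where
  "pos h \<longleftrightarrow> star h = h \<and> (\<forall>t>0. invertible_element (of_real t + h))"

text \<open>Write \<open>t + h\<close> as \<open>(s + t) - (s - h)\<close> and use the Neumann
  series.\<close>

lemma posI_norm:
  assumes "star h = h" "norm (of_real s - h) \<le> s"
  shows "pos h"
  unfolding pos_def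
proof (intro conjI allI impI assms(1))
  fix t :: real assume "t > 0"
  then have "invertible_element (of_real (s + t) - (of_real s - h))"
    using assms(2) by (intro invertible_of_real_minus) simp
  then show "invertible_element (of_real t + h)" by (simp add: algebra_simps)
qed

lemma pos_scaleR:
  assumes "pos h" "c \<ge> 0"
  shows "pos (c *\<^sub>R h)"
proof (cases "c = 0")
  case True
  then show ?thesis using posI_norm[of 0 0] by (simp add: star_simps)
next
  case False
  then have c: "c > 0" using assms(2) by simp
  have "invertible_element (of_real t + c *\<^sub>R h)" if "t > 0" for t
  proof -
    have "invertible_element (of_real (t / c) + h)"
      using assms(1) c that by (simp add: pos_def)
    from invertible_element_scaleR[OF this, of c] c show ?thesis
      by (simp add: of_real_def scaleR_add_right)
  qed
  then show ?thesis using assms(1) by (simp add: pos_def star_simps)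
qed

end

locale hermitian_cstar = involutive_cstar +
  assumes hermitian: "star k = k \<Longrightarrow> invertible_element (1 + k * k)"
begin

text \<open>Completing the square gives \<open>(sin t)\<^sup>2 + (k - cos t)\<^sup>2\<close>, which
  \<open>hermitian\<close> handles unless \<open>sin t = 0\<close>; then the quadratic is the square
  of \<open>1 - k\<close> or of \<open>1 + k\<close>.\<close>

lemma selfadjoint_resolvent_quadratic_invertible:
  assumes k: "star k = k" and "invertible_element (1 - k)" "invertible_element (1 + k)"
  shows "invertible_element (resolvent_quadratic t k)"
proof (cases "sin t = 0")
  case True
  then have "cos t = 1 \<or> cos t = - 1"
    using sin_zero_abs_cos_one by fastforce
  then have "resolvent_quadratic t k = (1 - k) * (1 - k) \<or> resolvent_quadratic t k = (1 + k) * (1 + k)"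
    by (auto simp: resolvent_quadratic_def algebra_simps scaleR_2)
  then show ?thesis using assms(2,3) invertible_element_mult by metis
next
  case False
  let ?s = "sin t" and ?c = "cos t"
  define m where "m = (1 / ?s) *\<^sub>R (k - of_real ?c)"
  have "invertible_element (?s\<^sup>2 *\<^sub>R (1 + m * m))"
    using False k by (intro invertible_element_scaleR hermitian) (auto simp: m_def star_simps star_of_real)
  also have "?s\<^sup>2 *\<^sub>R (1 + m * m) = of_real (?s\<^sup>2) + (k - of_real ?c) * (k - of_real ?c)"
    using False by (simp add: m_def scaleR_add_right power2_eq_square of_real_def)
  also have "\<dots> = resolvent_quadratic t k"
  proof -
    have two: "(2 * ?c) *\<^sub>R k = ?c *\<^sub>R k + ?c *\<^sub>R k"
      by (simp add: scaleR_add_left[symmetric])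
    show ?thesis
      unfolding resolvent_quadratic_def sin_squared_eq two
      by (simp add: of_real_def algebra_simps power2_eq_square)
  qed
  finally show ?thesis .
qed

text \<open>If neither \<open>norm k\<close> nor its negative were in the spectrum of a nonzero
  \<open>k\<close>, the powers of the normalised element would tend to 0, whereas the C*-identity
  keeps its \<open>2 ^ n\<close>-th powers at norm 1.\<close>

lemma selfadjoint_spectral_radius:
  assumes k: "star k = k" and inv: "invertible_element (of_real (norm k) - k)"
    "invertible_element (of_real (norm k) + k)"
  shows "k = 0"
proof (rule ccontr)
  assume "k \<noteq> 0"
  then have n: "norm k > 0" by simp
  define l where "l = (1 / norm k) *\<^sub>R k"
  have l: "star l = l" "norm l = 1"
    using n k by (simp_all add: l_def star_simps)
  have i: "invertible_element (1 - l)" "invertible_element (1 + l)"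
    using invertible_element_scaleR[OF inv(1), of "1 / norm k"]
      invertible_element_scaleR[OF inv(2), of "1 / norm k"] n
    by (simp_all add: l_def of_real_def scaleR_diff_right scaleR_add_right)
  have "(\<lambda>n. l ^ n) \<longlonglongrightarrow> 0"
  proof (rule power_tendsto_zero_if_resolvents)
    fix r t :: real assume r: "0 \<le> r" "r \<le> 1"
    have "invertible_element (1 - r *\<^sub>R l)" "invertible_element (1 + r *\<^sub>R l)"
    proof -
      consider "r = 1" | "norm (r *\<^sub>R l) < 1" "norm (- (r *\<^sub>R l)) < 1" using r l by force
      then show "invertible_element (1 - r *\<^sub>R l)" "invertible_element (1 + r *\<^sub>R l)"
        using i invertible_element_Neumann[of "r *\<^sub>R l"] invertible_element_Neumann[of "- (r *\<^sub>R l)"]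
        by (cases; simp)+
    qed
    then show "invertible_element (resolvent_quadratic t (r *\<^sub>R l))"
      by (intro selfadjoint_resolvent_quadratic_invertible) (simp_all add: star_simps l)
  qed (simp add: l)
  then obtain N where N: "\<And>n. n \<ge> N \<Longrightarrow> norm (l ^ n) < 1"
    using LIMSEQ_D[of "\<lambda>n. l ^ n" 0 1] by auto
  have "N \<le> 2 ^ N" using less_exp[of N] by simp
  from N[OF this] show False
    using selfadjoint_norm_power[OF l(1), of N] l(2) by simp
qed

text \<open>For nonzero \<open>h\<close>, positivity keeps \<open>- norm h\<close> out of the
  spectrum, so \<open>norm h\<close> lies in it; hence \<open>t + norm h\<close> lies in the
  spectrum of \<open>t + h\<close>.\<close>

lemma pos_norm_add:
  assumes h: "pos h" and t: "0 \<le> t"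
  shows "norm (of_real t + h) = t + norm h"
proof (cases "h = 0")
  case True
  then show ?thesis using t by simp
next
  case False
  have "\<not> invertible_element (of_real (norm h) - h)"
    using selfadjoint_spectral_radius[of h] h False by (auto simp: pos_def)
  then have "\<not> norm (of_real t + h) < t + norm h"
    using invertible_of_real_minus[of "of_real t + h" "t + norm h"] by (auto simp: algebra_simps)
  moreover have "norm (of_real t + h) \<le> t + norm h"
    using norm_triangle_ineq[of "of_real t" h] t by simp
  ultimately show ?thesis by simp
qed

text \<open>If \<open>?k\<close> had norm above \<open>s\<close>, neither \<open>norm ?k\<close> nor
  its negative could be in the spectrum of \<open>?k\<close>: one is excluded by positivity of
  \<open>h\<close>, the other by the Neumann series.\<close>

lemma pos_norm_diff:
  assumes h: "pos h" and s: "norm h \<le> s"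
  shows "norm (of_real s - h) \<le> s"
proof (rule ccontr)
  let ?k = "of_real s - h"
  assume "\<not> norm ?k \<le> s"
  then have r: "s < norm ?k" by simp
  have s0: "0 \<le> s" using s norm_ge_zero order_trans by blast
  have "invertible_element (of_real (norm ?k - s) + h)"
    using h r by (simp add: pos_def del: of_real_diff)
  then have 1: "invertible_element (of_real (norm ?k) - ?k)"
    by (simp add: algebra_simps)
  have "invertible_element (of_real (norm ?k + s) - h)"
    using s s0 r by (intro invertible_of_real_minus) simp
  then have 2: "invertible_element (of_real (norm ?k) + ?k)"
    by (simp add: algebra_simps)
  have "?k = 0"
    using h by (intro selfadjoint_spectral_radius 1 2) (simp add: pos_def star_simps star_of_real)
  then show False using r s0 by simp
qed

text \<open>The norm description of positivity is additive by the triangle inequality, unlike the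
  one by invertibility.\<close>

lemma pos_add:
  assumes "pos h" "pos k"
  shows "pos (h + k)"
proof (rule posI_norm)
  show "star (h + k) = h + k" using assms by (simp add: pos_def star_simps)
  have "norm ((of_real (norm h) - h) + (of_real (norm k) - k)) \<le> norm h + norm k"
    by (rule norm_triangle_le) (intro add_mono pos_norm_diff assms order_refl)
  then show "norm (of_real (norm h + norm k) - (h + k)) \<le> norm h + norm k"
    by (simp add: algebra_simps)
qed

lemma pos_square:
  assumes "star k = k"
  shows "pos (k * k)"
proof -
  have "invertible_element (of_real t + k * k)" if "t > 0" for t
  proof -
    have "invertible_element (t *\<^sub>R (1 + ((1 / sqrt t) *\<^sub>R k) * ((1 / sqrt t) *\<^sub>R k)))"
      using that assms by (intro invertible_element_scaleR hermitian) (auto simp: star_simps)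
    then show ?thesis using that by (simp add: scaleR_add_right of_real_def)
  qed
  then show ?thesis using assms by (simp add: pos_def star_simps)
qed

text \<open>The norm of \<open>norm h + h\<close> is \<open>2 * norm h\<close> by positivity of
  \<open>h\<close>, and at most \<open>norm h\<close> by positivity of \<open>- h\<close>.\<close>

lemma pos_antisym:
  assumes "pos h" "pos (- h)"
  shows "h = 0"
  using pos_norm_add[OF assms(1), of "norm h"] pos_norm_diff[OF assms(2), of "norm h"] by simp

lemma pos_sqrt:
  assumes h: "pos h"
  obtains q where "pos q" "q * q = h" "\<And>z. z * h = h * z \<Longrightarrow> z * q = q * z"
proof (cases "h = 0")
  case True
  then show ?thesis using h that[of 0] by simp
next
  case False
  then have n: "norm h > 0" by simp
  define T where "T = 1 - (1 / norm h) *\<^sub>R h"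
  have "T = (1 / norm h) *\<^sub>R (of_real (norm h) - h)"
    using n by (simp add: T_def of_real_def scaleR_diff_right)
  then have T: "norm T \<le> 1"
    using pos_norm_diff[OF h order_refl] n by simp
  have sT: "star T = T" using h by (simp add: T_def pos_def star_simps star_one)
  define q where "q = sqrt (norm h) *\<^sub>R sqrt_one_minus T"
  have "pos (sqrt_one_minus T)"
    using posI_norm[of "sqrt_one_minus T" 1] star_sqrt_one_minus[OF T sT]
      norm_one_minus_sqrt_one_minus_le[OF T] by simp
  then have "pos q" unfolding q_def by (intro pos_scaleR) auto
  moreover have "q * q = h"
    using n by (simp add: q_def sqrt_one_minus_square[OF T]) (simp add: T_def)
  moreover have "z * q = q * z" if "z * h = h * z" for z
    using sqrt_one_minus_commute[OF T, of z] that by (simp add: q_def T_def algebra_simps)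
  ultimately show ?thesis using that by blast
qed

end

subsection \<open>Real C*-algebras\<close>


context unital_real_cstar_algebra
begin

sublocale hermitian_cstar star
proof unfold_locales
  fix k assume "star k = k"
  then show "invertible_element (1 + k * k)"
    using one_plus_invertible[of k] by (auto simp: invertible_element_def)
qed

lemma pos_star_mult_self: "pos (star c * c)"
proof -
  have "invertible_element (of_real t + star c * c)" if "t > 0" for t
  proof -
    have "invertible_element (1 + star ((1 / sqrt t) *\<^sub>R c) * ((1 / sqrt t) *\<^sub>R c))"
      using one_plus_invertible unfolding invertible_element_def by blast
    then have "invertible_element (t *\<^sub>R (1 + star ((1 / sqrt t) *\<^sub>R c) * ((1 / sqrt t) *\<^sub>R c)))"
      using that by (intro invertible_element_scaleR) auto
    then show ?thesis using that by (simp add: scaleR_add_right of_real_def star_simps)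
  qed
  then show ?thesis by (simp add: pos_def star_simps)
qed

definition re :: "'a \<Rightarrow> 'a" where
  "re h = (1 / 2) *\<^sub>R (h + star h)"

lemma linear_re: "linear re"
  by (rule linearI) (simp_all add: re_def star_simps algebra_simps)

lemma re_selfadjoint: "star h = h \<Longrightarrow> re h = h"
  by (simp add: re_def scaleR_2[symmetric])

lemma norm_re_le: "norm (re h) \<le> norm h"
  using norm_triangle_ineq[of h "star h"] by (simp add: re_def norm_star)

text \<open>
  The inequality is the first order term of \<open>norm (2 e t + star z * z) = 2 e t + (norm z)\<^sup>2\<close>,
  where \<open>z = x + e b\<close> and \<open>e\<close> tends to \<open>0\<close>.
\<close>

lemma best_approximation_norm_ge:
  assumes best: "\<And>e. norm x \<le> norm (x + e *\<^sub>R b)" and t: "0 \<le> t" and l: "0 \<le> l"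
  shows "t + l * (norm x)\<^sup>2 \<le> norm (re (of_real t + l *\<^sub>R (star x * x) + star x * b))"
    (is "_ \<le> norm ?w")
proof (rule field_le_epsilon)
  fix d :: real assume d: "0 < d"
  let ?D = "(norm x)\<^sup>2" and ?N = "(norm b)\<^sup>2"
  have w: "?w = of_real t + l *\<^sub>R (star x * x) + re (star x * b)"
    by (simp add: linear_add[OF linear_re] linear_scale[OF linear_re] re_selfadjoint star_simps star_of_real)
  \<comment> \<open>The first bound keeps the coefficient \<open>1 - 2 * l * e\<close> below
    nonnegative; the second makes the quadratic remainder at most \<open>d\<close> after division by
    \<open>e\<close>.\<close>
  define e where "e = min (1 / (2 * l + 1)) (d / (?N + 1))"
  have N: "?N + 1 > 0" by (simp add: add_nonneg_pos)
  have e: "0 < e" using l d N by (auto simp: e_def)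
  have le1: "2 * l * e \<le> 1"
  proof -
    have "2 * l * e \<le> 2 * l * (1 / (2 * l + 1))"
      using l by (intro mult_left_mono) (auto simp: e_def)
    also have "\<dots> \<le> 1" using l by (simp add: field_simps)
    finally show ?thesis .
  qed
  have eN: "e * ?N \<le> d"
  proof -
    have "e * (?N + 1) \<le> d / (?N + 1) * (?N + 1)"
      using N by (intro mult_right_mono) (auto simp: e_def)
    also have "\<dots> = d" using N by simp
    finally show ?thesis using e by (simp add: algebra_simps)
  qed
  let ?z = "x + e *\<^sub>R b"
  have "2 * e * t + ?D \<le> 2 * e * t + (norm ?z)\<^sup>2"
    using best[of e] by (simp add: power_mono)
  also have "\<dots> = norm (of_real (2 * e * t) + star ?z * ?z)"
    using pos_norm_add[OF pos_star_mult_self[of ?z], of "2 * e * t"] e t by (simp add: cstar_identity)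
  also have "of_real (2 * e * t) + star ?z * ?z =
      (2 * e) *\<^sub>R ?w + ((1 - 2 * l * e) *\<^sub>R (star x * x) + e\<^sup>2 *\<^sub>R (star b * b))"
    unfolding w
    by (simp add: re_def star_simps of_real_def algebra_simps power2_eq_square)
  also have "norm \<dots> \<le> 2 * e * norm ?w + ((1 - 2 * l * e) * ?D + e\<^sup>2 * ?N)"
  proof (intro norm_triangle_le add_mono)
    show "norm ((2 * e) *\<^sub>R ?w) \<le> 2 * e * norm ?w" using e by simp
    show "norm ((1 - 2 * l * e) *\<^sub>R (star x * x)) \<le> (1 - 2 * l * e) * ?D"
      using le1 by (simp add: cstar_identity)
    show "norm (e\<^sup>2 *\<^sub>R (star b * b)) \<le> e\<^sup>2 * ?N" by (simp add: cstar_identity)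
  qed
  finally have "e * (2 * (t + l * ?D)) \<le> e * (2 * norm ?w + e * ?N)"
    by (simp add: algebra_simps power2_eq_square)
  then have "2 * (t + l * ?D) \<le> 2 * norm ?w + e * ?N"
    using e by simp
  then show "t + l * ?D \<le> norm ?w + d" using eN d by simp
qed

theorem best_approximation_state:
  assumes B: "subspace B" and best: "\<And>b. b \<in> B \<Longrightarrow> norm x \<le> norm (x + b)"
  obtains f where "linear f" "\<And>c. f (star c) = f c" "\<And>c. 0 \<le> f (star c * c)" "f 1 = 1"
    "f (star x * x) = (norm x)\<^sup>2" "\<And>b. b \<in> B \<Longrightarrow> f (star x * b) = 0"
proof -
  \<comment> \<open>The coordinates encode the lower bounds on \<open>f 1\<close>,
    \<open>f (star x * x)\<close> and \<open>f (star x * b)\<close>. The bound by the norm turns the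
    first two into equalities, and the sign change in \<open>B\<close> the third.\<close>
  define K :: "(real \<times> real \<times> 'a) set" where "K = {0..} \<times> {0..} \<times> B"
  define g :: "real \<times> real \<times> 'a \<Rightarrow> 'a" where
    "g = (\<lambda>(t, l, b). of_real t + l *\<^sub>R (star x * x) + star x * b)"
  define m :: "real \<times> real \<times> 'a \<Rightarrow> real" where "m = (\<lambda>(t, l, b). t + l * (norm x)\<^sup>2)"
  obtain f where f: "linear f" and f_le: "\<And>h. f h \<le> norm (re h)" and f_ge: "\<And>k. k \<in> K \<Longrightarrow> m k \<le> f (g k)"
  proof (rule Mazur_Orlicz[of "\<lambda>h. norm (re h)" g m K])
    show "sublinear (\<lambda>h. norm (re h))"
      unfolding sublinear_def
      by (simp add: linear_add[OF linear_re] linear_scale[OF linear_re] norm_triangle_ineq)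
    show "linear g" by (rule linearI) (auto simp: g_def algebra_simps of_real_def)
    show "linear m" by (rule linearI) (auto simp: m_def algebra_simps)
    show "0 \<in> K" using subspace_0[OF B] by (simp add: K_def zero_prod_def)
    show "k + l \<in> K" if "k \<in> K" "l \<in> K" for k l
      using that subspace_add[OF B] by (auto simp: K_def)
    show "c *\<^sub>R k \<in> K" if "0 < c" "k \<in> K" for c k
      using that subspace_scale[OF B] by (auto simp: K_def)
    show "m k \<le> norm (re (g k))" if "k \<in> K" for k
      using that best_approximation_norm_ge[of x "snd (snd k)" "fst k" "fst (snd k)"]
        best subspace_scale[OF B] by (auto simp: K_def m_def g_def)
  qed blast
  have f_le_norm: "f h \<le> norm h" for h using f_le[of h] norm_re_le[of h] by simp
  have ge: "t + l * (norm x)\<^sup>2 \<le> f (of_real t + l *\<^sub>R (star x * x) + star x * b)"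
    if "0 \<le> t" "0 \<le> l" "b \<in> B" for t l b
    using f_ge[of "(t, l, b)"] that by (simp add: K_def m_def g_def)
  note 0 = subspace_0[OF B]
  have f1: "f 1 = 1" using ge[of 1 0 0] 0 f_le_norm[of 1] by simp
  have fx: "f (star x * x) = (norm x)\<^sup>2"
    using ge[of 0 1 0] 0 f_le_norm[of "star x * x"] by (simp add: cstar_identity)
  have fb: "f (star x * b) = 0" if "b \<in> B" for b
    using ge[of 0 0 b] ge[of 0 0 "- b"] subspace_neg[OF B that] that by (simp add: linear_neg[OF f])
  have skew: "f h \<le> 0" if "star h = - h" for h
    using f_le[of h] that by (simp add: re_def)
  have fstar: "f (star c) = f c" for c
    using skew[of "c - star c"] skew[of "star c - c"] by (simp add: star_simps linear_diff[OF f])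
  have fpos: "0 \<le> f (star c * c)" for c
  proof -
    have "f (of_real (norm (star c * c)) - star c * c) \<le> norm (star c * c)"
      using f_le_norm pos_norm_diff[OF pos_star_mult_self order_refl] order_trans by blast
    then show ?thesis by (simp add: of_real_def linear_diff[OF f] linear_scale[OF f] f1)
  qed
  show ?thesis using that[OF f fstar fpos f1 fx fb] .
qed

end

subsection \<open>Complex C*-algebras\<close>


context unital_complex_cstar_algebra
begin

sublocale real: involutive_cstar star
proof
  fix r :: real and x :: 'a
  show "star (r *\<^sub>R x) = r *\<^sub>R star x"
    using star_scale[of "of_real r" x] by (simp add: scale_of_real)
qed (simp_all add: scaleR_add_right scaleR_add_left star_add star_mult star_star cstar_identity)

lemma scaleC_scaleR: "scaleC c (r *\<^sub>R x) = r *\<^sub>R scaleC c x"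
  by (simp add: scale_of_real[symmetric] mult.commute)

lemma scaleC_ii: "scaleC \<i> (scaleC \<i> x) = - x"
  by simp

lemmas scaleC_simps = scale_mult_left scale_mult_right scale_right_distrib
  scale_right_diff_distrib scaleC_scaleR scaleC_ii star_scale

text \<open>Shifting \<open>k\<close> by \<open>- t \<i>\<close> raises the square of its norm only
  to \<open>(norm k)\<^sup>2 + t\<^sup>2\<close> at most. For \<open>t = (norm k)\<^sup>2\<close>
  this is below \<open>(1 + t)\<^sup>2\<close>, so the Neumann series reaches the point in
  question.\<close>

lemma selfadjoint_add_i_invertible:
  assumes k: "star k = k"
  shows "invertible_element (k + scaleC \<i> 1)"
proof -
  define t where "t = (norm k)\<^sup>2"
  let ?w = "k - t *\<^sub>R scaleC \<i> 1"
  have "(norm ?w)\<^sup>2 = norm (star ?w * ?w)" by (simp add: cstar_identity)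
  also have "star ?w * ?w = k * k + (t * t) *\<^sub>R 1"
    by (simp add: real.star_simps real.star_one k scaleC_simps algebra_simps)
  also have "norm \<dots> \<le> t + t * t"
  proof (intro norm_triangle_le add_mono)
    show "norm (k * k) \<le> t" using norm_mult_ineq[of k k] by (simp add: t_def power2_eq_square)
  qed simp
  also have "\<dots> < (1 + t)\<^sup>2"
    using zero_le_power2[of "norm k"] by (simp add: t_def power2_eq_square algebra_simps add_pos_nonneg)
  finally have "norm ?w < 1 + t"
    by (rule power2_less_imp_less) (simp add: t_def)
  then have "invertible_element (of_real (1 + t) - scaleC \<i> ?w)"
    by (intro invertible_of_real_minus) (simp add: norm_scale)
  moreover have "invertible_element (scaleC \<i> 1)"
    by (rule invertible_elementI[of "- scaleC \<i> 1"]) (simp_all add: scaleC_simps)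
  ultimately have "invertible_element (scaleC \<i> 1 * (of_real (1 + t) - scaleC \<i> ?w))"
    by (intro invertible_element_mult)
  also have "scaleC \<i> 1 * (of_real (1 + t) - scaleC \<i> ?w) = k + scaleC \<i> 1"
    by (simp add: of_real_def scaleC_simps algebra_simps)
  finally show ?thesis .
qed

sublocale real: hermitian_cstar star
proof
  fix k assume k: "star k = k"
  have "invertible_element (- (- k + scaleC \<i> 1))"
    using k by (intro invertible_element_uminus selfadjoint_add_i_invertible) (simp add: real.star_simps)
  then have "invertible_element ((k + scaleC \<i> 1) * - (- k + scaleC \<i> 1))"
    using selfadjoint_add_i_invertible[OF k] by (intro invertible_element_mult)
  also have "(k + scaleC \<i> 1) * - (- k + scaleC \<i> 1) = 1 + k * k"
    by (simp add: scaleC_simps algebra_simps)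
  finally show "invertible_element (1 + k * k)" .
qed

text \<open>The sum is twice the sum of the squares of the self-adjoint real and imaginary parts
  \<open>A\<close> and \<open>B\<close> of \<open>y\<close>.\<close>

lemma pos_commutator_sum: "real.pos (star y * y + y * star y)"
proof -
  define A where "A = (1 / 2) *\<^sub>R (y + star y)"
  define B where "B = (1 / 2) *\<^sub>R scaleC \<i> (star y - y)"
  have sA: "star A = A" by (simp add: A_def real.star_simps add.commute)
  have sB: "star B = B" by (simp add: B_def real.star_simps scaleC_simps algebra_simps)
  have "real.pos (2 *\<^sub>R (A * A + B * B))"
    by (intro real.pos_scaleR real.pos_add real.pos_square sA sB) simp
  also have "B * B = - (1 / 4) *\<^sub>R ((star y - y) * (star y - y))"
    by (simp add: B_def scaleC_simps algebra_simps)
  also have "2 *\<^sub>R (A * A + - (1 / 4) *\<^sub>R ((star y - y) * (star y - y))) = star y * y + y * star y"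
    by (simp add: A_def algebra_simps) (simp add: scaleR_add_left[symmetric])
  finally show ?thesis .
qed

text \<open>By Jacobson's lemma the spectra of \<open>star y * y\<close> and
  \<open>y * star y\<close> agree away from 0.\<close>

lemma pos_uminus_commute:
  assumes "real.pos (- (star y * y))"
  shows "real.pos (- (y * star y))"
  unfolding real.pos_def
proof (intro conjI allI impI)
  fix t :: real assume t: "t > 0"
  have "invertible_element (of_real t + - (star y * y))"
    using assms t by (simp only: real.pos_def)
  from invertible_element_scaleR[OF this, of "1 / t"] t
  have "invertible_element (1 - ((1 / t) *\<^sub>R star y) * y)"
    by (simp add: of_real_def scaleR_diff_right)
  then have "invertible_element (1 - y * ((1 / t) *\<^sub>R star y))"
    by (rule invertible_one_minus_commute)
  from invertible_element_scaleR[OF this, of t] t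
  show "invertible_element (of_real t + - (y * star y))"
    by (simp add: of_real_def scaleR_diff_right)
qed (simp add: real.star_simps)

lemma star_mult_self_neg_imp_0:
  assumes "real.pos (- (star y * y))"
  shows "y = 0"
proof -
  have "real.pos ((star y * y + y * star y) + - (y * star y))"
    by (intro real.pos_add pos_commutator_sum pos_uminus_commute assms)
  then have "real.pos (star y * y)" by simp
  then show ?thesis
    using real.pos_antisym assms real.star_mult_self_eq_0 by blast
qed

text \<open>
  Kaplansky's argument with \<open>q - h\<close>, where \<open>q\<close> is the square root of \<open>h * h\<close>, in the role of
  twice the negative part of \<open>h\<close>.
\<close>

lemma pos_star_mult_self: "real.pos (star x * x)"
proof -
  define h where "h = star x * x"
  have sh: "star h = h" by (simp add: h_def real.star_simps)
  obtain q where q: "real.pos q" "q * q = h * h" and comm: "\<And>z. z * (h * h) = (h * h) * z \<Longrightarrow> z * q = q * z"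
    using real.pos_sqrt[OF real.pos_square[OF sh]] by blast
  have hq: "h * q = q * h" using comm[of h] by (simp add: mult.assoc)
  define v where "v = q - h"
  have hv: "h * v = v * h" by (simp add: v_def hq algebra_simps)
  have vv: "v * v = - 2 *\<^sub>R (h * v)"
    by (simp add: v_def algebra_simps q(2) hq scaleR_2)
  \<comment> \<open>Because \<open>q * q = h * h\<close>, the product of \<open>t + v\<close> and
    \<open>t + (q + h)\<close> is \<open>t * (t + 2 q)\<close>, so \<open>t + v\<close> is a
    commuting factor of an invertible element.\<close>
  have "real.pos v"
    unfolding real.pos_def
  proof (intro conjI allI impI)
    show "star v = v" using q(1) by (simp add: v_def real.star_simps sh real.pos_def)
    fix t :: real assume t: "t > 0"
    have "real.pos (2 *\<^sub>R q)" by (intro real.pos_scaleR q) simp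
    then have "invertible_element (of_real t + 2 *\<^sub>R q)"
      using t by (simp add: real.pos_def)
    then have "invertible_element (t *\<^sub>R (of_real t + 2 *\<^sub>R q))"
      using t by (intro invertible_element_scaleR) auto
    also have "t *\<^sub>R (of_real t + 2 *\<^sub>R q) = (of_real t + v) * (of_real t + (q + h))"
      by (simp add: v_def of_real_def algebra_simps scaleR_2 q(2) hq)
    finally show "invertible_element (of_real t + v)"
      by (rule invertible_element_left_factor) (simp add: v_def of_real_def algebra_simps hq)
  qed
  then obtain w where w: "real.pos w" "w * w = v" and wcomm: "\<And>z. z * v = v * z \<Longrightarrow> z * w = w * z"
    using real.pos_sqrt by blast
  have hw: "h * w = w * h" by (rule wcomm[OF hv])
  \<comment> \<open>The root \<open>w\<close> of \<open>v\<close> exhibits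
    \<open>h * (h * v)\<close> as the square of a self-adjoint element. Twice it is also
    \<open>- (star (x * v) * (x * v))\<close>, by the formula for \<open>v * v\<close>, and this
    forces \<open>x * v = 0\<close>.\<close>
  have "star (h * w) = h * w" using w(1) by (simp add: real.star_simps sh hw real.pos_def)
  then have "real.pos (2 *\<^sub>R ((h * w) * (h * w)))"
    by (intro real.pos_scaleR real.pos_square) simp_all
  also have "(h * w) * (h * w) = h * (h * v)"
    using hw by (metis mult.assoc w(2))
  also have "2 *\<^sub>R (h * (h * v)) = - (star (x * v) * (x * v))"
  proof -
    have "star (x * v) * (x * v) = v * h * v"
      using \<open>real.pos v\<close> by (simp add: real.star_simps h_def mult.assoc real.pos_def)
    also have "\<dots> = h * (v * v)" by (simp add: hv[symmetric] mult.assoc)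
    finally show ?thesis by (simp add: vv)
  qed
  finally have "x * v = 0" by (rule star_mult_self_neg_imp_0)
  then have "h * v = 0" by (simp add: h_def mult.assoc)
  then have "v * v = 0" using vv by simp
  then have "v = 0"
    using \<open>real.pos v\<close> real.star_mult_self_eq_0[of v] by (simp add: real.pos_def)
  then show ?thesis using q(1) by (simp add: v_def h_def)
qed

sublocale real: unital_real_cstar_algebra star
proof
  fix x
  have "invertible_element (of_real 1 + star x * x)"
    using pos_star_mult_self[of x] unfolding real.pos_def by (metis zero_less_one)
  then show "\<exists>y. y * (1 + star x * x) = 1 \<and> (1 + star x * x) * y = 1"
    by (simp add: invertible_element_def)
qed

end

subsection \<open>Maximum over the states\<close>


lemma best_approximation_norm_le:
  assumes best: "best_approximation a B b\<^sub>0" and "b\<^sub>0 - b \<in> B"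
  shows "norm (a - b\<^sub>0) \<le> norm (a - b\<^sub>0 + b)"
  using infdist_le[OF assms(2), of a] best
  by (simp add: best_approximation_def dist_norm algebra_simps)

context involutive_cstar
begin

text \<open>Positive elements are those of the form \<open>star c * c\<close>, so the bound needs a
  \<open>c\<close> for \<open>1 - T\<close>; the binomial square root supplies it.\<close>

lemma positive_functional_le:
  fixes f :: "'a \<Rightarrow> 'k::real_normed_field"
  assumes add: "\<And>u v. f (u + v) = f u + f v" and scale: "\<And>r u. f (r *\<^sub>R u) = of_real r * f u"
    and nonneg: "\<And>c. f (star c * c) \<in> \<real>\<^sub>\<ge>\<^sub>0" and one: "f 1 = 1"
  shows "\<exists>r\<le>(norm x)\<^sup>2. f (star x * x) = of_real r"
proof (cases "x = 0")
  case True
  then show ?thesis using scale[of 0 0] by (intro exI[of _ 0]) simp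
next
  case False
  then have D: "(norm x)\<^sup>2 > 0" by simp
  define T where "T = (1 / (norm x)\<^sup>2) *\<^sub>R (star x * x)"
  have T: "norm T \<le> 1" "star T = T"
    using D by (simp_all add: T_def cstar_identity star_simps)
  obtain r where r: "f (star x * x) = of_real r"
    using nonneg[of x] by (auto elim: nonneg_Reals_cases)
  have "star (sqrt_one_minus T) * sqrt_one_minus T = 1 + (- 1 / (norm x)\<^sup>2) *\<^sub>R (star x * x)"
    by (simp add: star_sqrt_one_minus T sqrt_one_minus_square) (simp add: T_def)
  then have "1 + of_real (- 1 / (norm x)\<^sup>2) * of_real r \<in> (\<real>\<^sub>\<ge>\<^sub>0 :: 'k set)"
    using nonneg[of "sqrt_one_minus T"] by (simp only: add scale one r)
  then have "(of_real (1 + (- 1 / (norm x)\<^sup>2) * r) :: 'k) \<in> \<real>\<^sub>\<ge>\<^sub>0"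
    by (simp only: of_real_add of_real_mult of_real_1)
  then have "0 \<le> 1 + (- 1 / (norm x)\<^sup>2) * r"
    by (simp only: nonneg_Reals_of_real_iff)
  then have "r \<le> (norm x)\<^sup>2" using D by (simp add: field_simps)
  then show ?thesis using r by blast
qed

text \<open>Both scalar fields are covered: \<open>herm\<close> asks for symmetry only at real
  values, which a complex state provides through conjugation.\<close>

lemma is_maximum_functionals:
  fixes S :: "('a \<Rightarrow> 'k::real_normed_field) set"
  assumes add: "\<And>f u v. f \<in> S \<Longrightarrow> f (u + v) = f u + f v"
    and scale: "\<And>f r u. f \<in> S \<Longrightarrow> f (r *\<^sub>R u) = of_real r * f u"
    and nonneg: "\<And>f c. f \<in> S \<Longrightarrow> f (star c * c) \<in> \<real>\<^sub>\<ge>\<^sub>0" and one: "\<And>f. f \<in> S \<Longrightarrow> f 1 = 1"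
    and herm: "\<And>f u v. f \<in> S \<Longrightarrow> f (star u * v) \<in> \<real> \<Longrightarrow> f (star v * u) = f (star u * v)"
    and best: "best_approximation a B b\<^sub>0"
    and attained: "\<exists>f\<in>S. f (star (a - b\<^sub>0) * (a - b\<^sub>0)) = of_real ((norm (a - b\<^sub>0))\<^sup>2) \<and>
      (\<forall>b\<in>B. f (star (a - b\<^sub>0) * b) = 0)"
  shows "is_maximum ((infdist a B)\<^sup>2) {f (star a * a) - f (star b\<^sub>0 * b\<^sub>0) | f.
    f \<in> S \<and> (\<forall>b\<in>B. f (star a * b) = f (star b\<^sub>0 * b))}"
proof -
  let ?x = "a - b\<^sub>0"
  have b0: "b\<^sub>0 \<in> B" and d: "infdist a B = norm ?x"
    using best by (simp_all add: best_approximation_def)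
  have diff: "f (u - v) = f u - f v" if "f \<in> S" for f u v
    using add[OF that, of "u - v" v] by simp
  have eq: "f (star a * a) - f (star b\<^sub>0 * b\<^sub>0) = f (star ?x * ?x)"
    if f: "f \<in> S" and orth: "\<forall>b\<in>B. f (star a * b) = f (star b\<^sub>0 * b)" for f
  proof -
    \<comment> \<open>Both cross terms in the expansion of \<open>star ?x * ?x\<close> thereby
      become \<open>f (star b\<^sub>0 * b\<^sub>0)\<close>, one by the constraint at
      \<open>b\<^sub>0\<close>, the other by \<open>herm\<close>.\<close>
    have 1: "f (star a * b\<^sub>0) = f (star b\<^sub>0 * b\<^sub>0)" using orth b0 by blast
    moreover have "f (star b\<^sub>0 * b\<^sub>0) \<in> \<real>"
      using nonneg[OF f] nonneg_Reals_subset_Reals by blast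
    ultimately have "f (star b\<^sub>0 * a) = f (star b\<^sub>0 * b\<^sub>0)" using herm[OF f, of a "b\<^sub>0"] by simp
    with 1 show ?thesis
      by (simp add: star_simps left_diff_distrib right_diff_distrib diff[OF f])
  qed
  show ?thesis
    unfolding is_maximum_def d
  proof (intro conjI ballI)
    obtain f where f: "f \<in> S" "f (star ?x * ?x) = of_real ((norm ?x)\<^sup>2)"
      "\<forall>b\<in>B. f (star ?x * b) = 0"
      using attained by blast
    have "\<forall>b\<in>B. f (star a * b) = f (star b\<^sub>0 * b)"
      using f(3) by (simp add: star_simps left_diff_distrib diff[OF f(1)])
    with eq[OF f(1)] f show "of_real ((norm ?x)\<^sup>2) \<in> {f (star a * a) - f (star b\<^sub>0 * b\<^sub>0) | f.
        f \<in> S \<and> (\<forall>b\<in>B. f (star a * b) = f (star b\<^sub>0 * b))}"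
      by (intro CollectI exI[of _ f]) simp
  next
    fix s assume "s \<in> {f (star a * a) - f (star b\<^sub>0 * b\<^sub>0) | f.
        f \<in> S \<and> (\<forall>b\<in>B. f (star a * b) = f (star b\<^sub>0 * b))}"
    then obtain f where f: "f \<in> S" "s = f (star ?x * ?x)" using eq by blast
    show "\<exists>r\<le>(norm ?x)\<^sup>2. s = of_real r"
      unfolding f(2) using f(1) by (intro positive_functional_le add scale nonneg one)
  qed
qed

end

lemma linear_functional_real_iff:
  "Vector_Spaces.linear scaleR (*) f \<longleftrightarrow> linear (f :: 'a::real_vector \<Rightarrow> real)"
proof -
  have "(*) = (scaleR :: real \<Rightarrow> real \<Rightarrow> real)"
    by (simp add: fun_eq_iff)
  then show ?thesis by (simp only: Real_Vector_Spaces.linear_def)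
qed

lemma (in unital_real_cstar_algebra) is_maximum_real_states:
  assumes B: "subspace B" and best: "best_approximation a B b\<^sub>0"
  shows "is_maximum ((infdist a B)\<^sup>2) {f (star a * a) - f (star b\<^sub>0 * b\<^sub>0) | f.
    f \<in> real_states star \<and> (\<forall>b\<in>B. f (star a * b) = f (star b\<^sub>0 * b))}"
proof (rule is_maximum_functionals[OF _ _ _ _ _ best])
  fix f :: "'a \<Rightarrow> real" assume f: "f \<in> real_states star"
  then have lin: "linear f"
    by (simp add: real_states_def positive_unital_functionals_def linear_functional_real_iff)
  show "f (u + v) = f u + f v" "f (r *\<^sub>R u) = of_real r * f u" for u v r
    using linear_add[OF lin] linear_scale[OF lin] by simp_all
  show "f (star c * c) \<in> \<real>\<^sub>\<ge>\<^sub>0" "f 1 = 1" for c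
    using f by (auto simp: real_states_def positive_unital_functionals_def positive_element_def)
  show "f (star v * u) = f (star u * v)" for u v
  proof -
    have "f (star (star u * v)) = f (star u * v)" using f by (simp only: real_states_def mem_Collect_eq)
    then show ?thesis by (simp add: star_simps)
  qed
next
  have "norm (a - b\<^sub>0) \<le> norm (a - b\<^sub>0 + b)" if "b \<in> B" for b
    using best that subspace_diff[OF B] by (intro best_approximation_norm_le) (auto simp: best_approximation_def)
  from best_approximation_state[OF B this] obtain f where f: "linear f" "\<And>c. f (star c) = f c"
    "\<And>c. 0 \<le> f (star c * c)" "f 1 = 1"
    "f (star (a - b\<^sub>0) * (a - b\<^sub>0)) = (norm (a - b\<^sub>0))\<^sup>2" "\<And>b. b \<in> B \<Longrightarrow> f (star (a - b\<^sub>0) * b) = 0"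
    by blast
  have "f \<in> real_states star"
    using f by (auto simp: real_states_def positive_unital_functionals_def positive_element_def linear_functional_real_iff
        nonneg_Reals_of_real_iff[where 'a = real, simplified])
  then show "\<exists>f\<in>real_states star. f (star (a - b\<^sub>0) * (a - b\<^sub>0)) = of_real ((norm (a - b\<^sub>0))\<^sup>2) \<and>
      (\<forall>b\<in>B. f (star (a - b\<^sub>0) * b) = 0)"
    using f by (intro bexI[of _ f]) auto
qed

context unital_complex_cstar_algebra
begin

lemma scaleC_Complex: "scaleC c x = Re c *\<^sub>R x + Im c *\<^sub>R scaleC \<i> x"
proof -
  have "scaleC c x = scaleC (of_real (Re c) + of_real (Im c) * \<i>) x"
    by (simp add: complex_eq mult.commute)
  then show ?thesis
    by (simp only: scale_left_distrib scale_scale[symmetric] scale_of_real)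
qed

text \<open>Polarization: reality at \<open>u + v\<close> makes the imaginary parts opposite, and
  replacing \<open>v\<close> by \<open>\<i> v\<close> makes the real parts equal.\<close>

lemma complex_functional_swap:
  fixes f :: "'a \<Rightarrow> complex"
  assumes add: "\<And>u v. f (u + v) = f u + f v" and scale: "\<And>c u. f (scaleC c u) = c * f u"
    and nonneg: "\<And>c. f (star c * c) \<in> \<real>\<^sub>\<ge>\<^sub>0"
  shows "f (star v * u) = cnj (f (star u * v))"
proof -
  have im: "Im (f (star c * c)) = 0" for c
    using nonneg[of c] by (simp add: complex_nonneg_Reals_iff)
  have sum: "Im (f (star u * v)) + Im (f (star v * u)) = 0" for u v
    using im[of "u + v"] im[of u] im[of v] by (simp add: real.star_simps distrib_left distrib_right add)
  have "Im (f (star u * scaleC \<i> v)) + Im (f (star (scaleC \<i> v) * u)) = 0"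
    by (rule sum)
  moreover have "f (star (scaleC \<i> v) * u) = - \<i> * f (star v * u)"
    by (simp only: star_scale complex_cnj_i scale_mult_left scale)
  moreover have "f (star u * scaleC \<i> v) = \<i> * f (star u * v)"
    by (simp only: scale_mult_right scale)
  ultimately show ?thesis using sum[of u v] by (simp add: complex_eq_iff)
qed

lemma complexified_state:
  assumes lin: "linear f" and sym: "\<And>c. f (star c) = f c" and nonneg: "\<And>c. 0 \<le> f (star c * c)"
    and one: "f 1 = 1"
  defines "g \<equiv> \<lambda>c. Complex (f c) (- f (scaleC \<i> c))"
  shows "g \<in> complex_states scaleC star" "\<And>c. g (star c * c) = of_real (f (star c * c))"
proof -
  \<comment> \<open>The element \<open>\<i> h\<close> is skew, and the symmetric functional
    \<open>f\<close> vanishes on skew elements; hence \<open>g\<close> is real on self-adjoint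
    elements.\<close>
  have zero: "f (scaleC \<i> h) = 0" if "star h = h" for h
    using sym[of "scaleC \<i> h"] that by (simp add: star_scale linear_neg[OF lin])
  show sq: "g (star c * c) = of_real (f (star c * c))" for c
    using zero[of "star c * c"] by (simp add: g_def real.star_simps complex_eq_iff)
  have "Vector_Spaces.linear scaleC (*) g"
  proof unfold_locales
    fix x y c
    show "g (x + y) = g x + g y"
      by (simp add: g_def scale_right_distrib linear_add[OF lin] complex_eq_iff)
    have "f (scaleC \<i> (scaleC c x)) = Re c * f (scaleC \<i> x) - Im c * f x"
      by (subst scaleC_Complex[of c])
        (simp add: scaleC_simps linear_add[OF lin] linear_diff[OF lin] linear_scale[OF lin])
    then show "g (scaleC c x) = c * g x"
      unfolding g_def
      by (subst scaleC_Complex[of c])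
        (simp add: linear_add[OF lin] linear_scale[OF lin] complex_eq_iff)
  qed
  moreover have "g 1 = 1"
    using zero[of 1] by (simp add: g_def one real.star_one complex_eq_iff)
  ultimately show "g \<in> complex_states scaleC star"
    using sq nonneg by (auto simp: complex_states_def positive_unital_functionals_def positive_element_def)
qed

lemma is_maximum_complex_states:
  assumes B: "subspace B" and best: "best_approximation a B b\<^sub>0"
  shows "is_maximum ((infdist a B)\<^sup>2) {f (star a * a) - f (star b\<^sub>0 * b\<^sub>0) | f.
    f \<in> complex_states scaleC star \<and> (\<forall>b\<in>B. f (star a * b) = f (star b\<^sub>0 * b))}"
proof (rule real.is_maximum_functionals[OF _ _ _ _ _ best])
  fix f :: "'a \<Rightarrow> complex" assume f: "f \<in> complex_states scaleC star"
  then have lin: "Vector_Spaces.linear scaleC (*) f"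
    by (simp add: complex_states_def positive_unital_functionals_def)
  show add: "f (u + v) = f u + f v" for u v
    using lin by (simp add: Vector_Spaces.linear_iff)
  have scale: "f (scaleC c u) = c * f u" for c u
    using lin by (simp add: Vector_Spaces.linear_iff)
  show "f (r *\<^sub>R u) = of_real r * f u" for r u
    using scale[of "of_real r" u] by (simp add: scale_of_real)
  show nonneg: "f (star c * c) \<in> \<real>\<^sub>\<ge>\<^sub>0" and "f 1 = 1" for c
    using f by (auto simp: complex_states_def positive_unital_functionals_def positive_element_def)
  show "f (star v * u) = f (star u * v)" if "f (star u * v) \<in> \<real>" for u v
    unfolding complex_functional_swap[OF add scale nonneg, of v u] using that
    by (simp add: Reals_cnj_iff)
next
  have "real.subspace B"
    unfolding real.subspace_def
  proof (intro conjI ballI allI)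
    show "0 \<in> B" "\<And>u v. u \<in> B \<Longrightarrow> v \<in> B \<Longrightarrow> u + v \<in> B"
      using B by (auto simp: subspace_def)
    show "r *\<^sub>R u \<in> B" if "u \<in> B" for r u
      using subspace_scale[OF B that, of "of_real r"] by (simp add: scale_of_real)
  qed
  moreover have "norm (a - b\<^sub>0) \<le> norm (a - b\<^sub>0 + b)" if "b \<in> B" for b
    using best that subspace_diff[OF B] by (intro best_approximation_norm_le) (auto simp: best_approximation_def)
  ultimately obtain f where f: "linear f" "\<And>c. f (star c) = f c"
    "\<And>c. 0 \<le> f (star c * c)" "f 1 = 1"
    "f (star (a - b\<^sub>0) * (a - b\<^sub>0)) = (norm (a - b\<^sub>0))\<^sup>2" "\<And>b. b \<in> B \<Longrightarrow> f (star (a - b\<^sub>0) * b) = 0"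
    using real.best_approximation_state[of B "a - b\<^sub>0"] by blast
  define g where "g = (\<lambda>c. Complex (f c) (- f (scaleC \<i> c)))"
  note state = complexified_state[OF f(1-4)]
  have "g (star (a - b\<^sub>0) * (a - b\<^sub>0)) = of_real ((norm (a - b\<^sub>0))\<^sup>2)"
    using state(2)[of "a - b\<^sub>0"] by (simp only: g_def f(5))
  \<comment> \<open>The imaginary part vanishes because \<open>B\<close> is a complex subspace and
    contains \<open>\<i> b\<close>.\<close>
  moreover have "g (star (a - b\<^sub>0) * b) = 0" if "b \<in> B" for b
    using f(6)[OF that] f(6)[OF subspace_scale[OF B that, of \<i>]]
    by (simp add: g_def scale_mult_right complex_eq_iff)
  ultimately show "\<exists>g\<in>complex_states scaleC star.
      g (star (a - b\<^sub>0) * (a - b\<^sub>0)) = of_real ((norm (a - b\<^sub>0))\<^sup>2) \<and>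
      (\<forall>b\<in>B. g (star (a - b\<^sub>0) * b) = 0)"
    using state(1)[folded g_def] by blast
qed

end

theorem corollary1p2:
  fixes a b\<^sub>0 :: "'a::{real_normed_algebra_1, banach}"
    and B :: "'a set"
    and star :: "'a \<Rightarrow> 'a"
    and scaleC :: "complex \<Rightarrow> 'a \<Rightarrow> 'a"
  shows "(unital_real_cstar_algebra star \<and> subspace B \<and> best_approximation a B b\<^sub>0 \<longrightarrow>
            is_maximum ((infdist a B)\<^sup>2)
              {\<phi> (star a * a) - \<phi> (star b\<^sub>0 * b\<^sub>0) | \<phi>. \<phi> \<in> real_states star \<and>
                 (\<forall>b\<in>B. \<phi> (star a * b) = \<phi> (star b\<^sub>0 * b))}) \<and>
         (unital_complex_cstar_algebra scaleC star \<and> module.subspace scaleC B \<and>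
          best_approximation a B b\<^sub>0 \<longrightarrow>
            is_maximum ((infdist a B)\<^sup>2)
              {\<phi> (star a * a) - \<phi> (star b\<^sub>0 * b\<^sub>0) | \<phi>. \<phi> \<in> complex_states scaleC star \<and>
                 (\<forall>b\<in>B. \<phi> (star a * b) = \<phi> (star b\<^sub>0 * b))})"
  using unital_real_cstar_algebra.is_maximum_real_states[of star B a b\<^sub>0, folded subspace_raw_def]
    unital_complex_cstar_algebra.is_maximum_complex_states[of scaleC star B a b\<^sub>0]
  by blast

end
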